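(* Let $\kappa\ge2$, $n\ge1$ be integers and $0<\epsilon<1$. Let $\check q$ be the first subspace exclusion code vector: $\check q_i=0$ for $0\le i<2^{\kappa-1}$ and $\check q_i=2^{1-\kappa}$ for $2^{\kappa-1}\le i\le 2^\kappa-1$. Let $\mathcal{C}_{\rho}$ be the set of $q\in\mathbb{R}^{2^\kappa}$ with $q_0=0$, $q_i\ge0$ for all $i$, $\sum_i q_i=1$, and $\Big(\sum_{i=1}^{2^\kappa-1}\big(q_i-\tfrac{1}{2^\kappa-1}\big)^2\Big)^{1/2}=\sqrt{\frac{2^{\kappa-1}-1}{(2^\kappa-2^{\kappa-1})(2^\kappa-1)}}.$ Then $\check q\in\mathcal{C}_\rho$ and $\check q$ is a local minimizer of $q\mapsto l(n,\epsilon,q)$ on $\mathcal{C}_\rho$.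
   Context: $W=\mathbb{F}_2^\kappa$; $\nu(i)\in W$ is the binary expansion of $i\in\{0,\dots,2^\kappa-1\}$ (so $\{\nu(i):i<2^{\kappa-1}\}$ is a $(\kappa-1)$-dimensional subspace); vectors $q\in\mathbb{R}^{2^\kappa}$ are indexed $q_0,\dots,q_{2^\kappa-1}$. For a subspace $S\subseteq W$, $\zeta(S,q)=\sum_{i:\nu(i)\in S}q_i$; $\Xi(W,d)$ is the set of $d$-dimensional subspaces of $W$. For real $q$, the (continuous) expected equivocation loss is $l(n,\epsilon,q)=n(1-\epsilon)-\kappa+\sum_{\delta=1}^{\kappa}K_\delta\sum_{S\in\Xi(W,\kappa-\delta)}\epsilon^{n(1-\zeta(S,q))}$, with $K_\delta=\prod_{i=1}^{\delta-1}(1-2^i)$. The radius condition says that $(q_1,\dots,q_{2^\kappa-1})$ lies at the same Euclidean distance from the uniform vector $(\frac{1}{2^\kappa-1},\dots)$ as $(\check q_1,\dots,\check q_{2^\kappa-1})$ does. A local minimizer of $f$ on a set $\mathcal{C}$ is a point $q\in\mathcal{C}$ with $f(q)\le f(q')$ for all $q'\in\mathcal{C}$ in some neighborhood of $q$. *)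

theory Defs
  imports "HOL-Analysis.Analysis"
begin

(* Vectors of W = F_2^kappa are represented as functions nat => bool that vanish
   at coordinates >= kappa; pointwise xor is vector addition over F_2. *)
definition Wsp :: "nat \<Rightarrow> (nat \<Rightarrow> bool) set" where
  "Wsp k = {v. \<forall>j\<ge>k. \<not> v j}"

definition nu :: "nat \<Rightarrow> nat \<Rightarrow> (nat \<Rightarrow> bool)" where
  "nu k i = (\<lambda>j. j < k \<and> bit i j)"

definition f2sum :: "(nat \<Rightarrow> bool) set \<Rightarrow> (nat \<Rightarrow> bool)" where
  "f2sum T = (\<lambda>j. odd (card {v\<in>T. v j}))"

definition f2span :: "(nat \<Rightarrow> bool) set \<Rightarrow> (nat \<Rightarrow> bool) set" where
  "f2span B = {f2sum T | T. T \<subseteq> B}"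

definition f2indep :: "(nat \<Rightarrow> bool) set \<Rightarrow> bool" where
  "f2indep B \<longleftrightarrow> finite B \<and> (\<forall>T\<subseteq>B. f2sum T = (\<lambda>_. False) \<longrightarrow> T = {})"

definition Xi :: "nat \<Rightarrow> nat \<Rightarrow> (nat \<Rightarrow> bool) set set" where
  "Xi k d = {S. \<exists>B. B \<subseteq> Wsp k \<and> f2indep B \<and> card B = d \<and> S = f2span B}"

definition zeta :: "nat \<Rightarrow> (nat \<Rightarrow> bool) set \<Rightarrow> (nat \<Rightarrow> real) \<Rightarrow> real" where
  "zeta k S q = (\<Sum>i \<in> {i. i < 2^k \<and> nu k i \<in> S}. q i)"

definition Kc :: "nat \<Rightarrow> real" where
  "Kc d = (\<Prod>i=1..<d. 1 - 2^i)"

definition loss :: "nat \<Rightarrow> nat \<Rightarrow> real \<Rightarrow> (nat \<Rightarrow> real) \<Rightarrow> real" where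
  "loss k n eps q = real n * (1 - eps) - real k
     + (\<Sum>d=1..k. Kc d * (\<Sum>S\<in>Xi k (k - d). eps powr (real n * (1 - zeta k S q))))"

definition qcheck :: "nat \<Rightarrow> nat \<Rightarrow> real" where
  "qcheck k i = (if i < 2^(k-1) then 0 else if i < 2^k then 2 powr (1 - real k) else 0)"

(* the constraint set C_rho; vectors q in R^(2^kappa) are q :: nat => real, only
   the coordinates 0..2^kappa-1 matter *)
definition Crho :: "nat \<Rightarrow> (nat \<Rightarrow> real) set" where
  "Crho k = {q. q 0 = 0 \<and> (\<forall>i<2^k. q i \<ge> 0) \<and> (\<Sum>i<2^k. q i) = 1 \<and>
      sqrt (\<Sum>i=1..<2^k. (q i - 1 / (2^k - 1))^2)
        = sqrt ((2^(k-1) - 1) / ((2^k - 2^(k-1)) * (2^k - 1)))}"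

definition vdist :: "nat \<Rightarrow> (nat \<Rightarrow> real) \<Rightarrow> (nat \<Rightarrow> real) \<Rightarrow> real" where
  "vdist k q q' = sqrt (\<Sum>i<2^k. (q i - q' i)^2)"

definition local_min_on :: "nat \<Rightarrow> ((nat \<Rightarrow> real) \<Rightarrow> real) \<Rightarrow> (nat \<Rightarrow> real) set \<Rightarrow> (nat \<Rightarrow> real) \<Rightarrow> bool" where
  "local_min_on k f C q \<longleftrightarrow> q \<in> C \<and>
     (\<exists>r>0. \<forall>q'\<in>C. vdist k q q' < r \<longrightarrow> f q \<le> f q')"

end

theory Submission
  imports Defs
begin

text \<open>Put \<open>\<lambda> = -n ln \<epsilon>\<close>, let \<open>H\<close> be the excluded hyperplane, \<open>A\<close> its complement and
  \<open>c = \<lambda> / |H|\<close>. On the constraint set the loss is, up to an affine change, the sum over all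
  subspaces \<open>S\<close> of \<open>K_S exp (\<lambda> \<zeta>(S, q))\<close>, and \<open>q\<close> is compared with the uniform distribution
  on \<open>A\<close>. For a displacement \<open>z\<close> inside the constraint set, the radius condition gives
  \<open>\<Sum>_H z = |H| |z|^2 / 2\<close>, and \<open>\<Sum>_A z = - \<Sum>_H z\<close>. Transvections preserving \<open>H\<close> act transitively
  on \<open>A\<close>, on \<open>H - {0}\<close> and on \<open>A \<times> (H - {0})\<close>, so that the gradient is constant on \<open>A\<close> and on
  \<open>H - {0}\<close> and the Hessian on \<open>A\<close> has constant diagonal and constant off-diagonal part. The loss
  therefore increases by a positive multiple of \<open>(c U'(c) + 1 - U(c)) |z|^2\<close> up to a cubic error,
  where \<open>U(c)\<close> is the sum of \<open>K_S exp (c |S \<inter> A|)\<close> over the subspaces avoiding a fixed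
  \<open>h \<in> H - {0}\<close>. By the Moebius-type identity that \<open>K_S\<close> sums to 1 over the subspaces containing a
  given subspace \<open>V\<close> and avoiding a given \<open>h \<notin> V\<close>, the \<open>n\<close>-th Taylor coefficient of \<open>U\<close> is
  \<open>1 / n!\<close> times the number of \<open>n\<close>-tuples in \<open>A\<close> that do not span \<open>h\<close>. Hence \<open>U(0) = 1\<close>, the
  coefficients of \<open>c U' + 1 - U\<close> are nonnegative, and that of \<open>c^2\<close> is positive.\<close>

section \<open>Subspaces of the binary vector space\<close>

abbreviation vzero :: "nat \<Rightarrow> bool" where
  "vzero \<equiv> (\<lambda>_. False)"

definition vadd :: "(nat \<Rightarrow> bool) \<Rightarrow> (nat \<Rightarrow> bool) \<Rightarrow> nat \<Rightarrow> bool" where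
  "vadd u v = (\<lambda>j. u j \<noteq> v j)"

interpretation vadd: comm_monoid vadd vzero
  by standard (auto simp: vadd_def)

lemma vadd_self [simp]: "vadd v v = vzero"
  by (simp add: vadd_def)

lemma vadd_left_invol [simp]: "vadd u (vadd u v) = v"
  by (simp flip: vadd.assoc)

lemma vadd_right_invol [simp]: "vadd (vadd v u) u = v"
  by (simp add: vadd.assoc)

lemma vadd_eq_vzero_iff [simp]: "vadd u v = vzero \<longleftrightarrow> u = v"
  by (auto simp: vadd_def fun_eq_iff)

lemma inj_on_vadd: "inj_on (vadd u) S"
  by (metis inj_onI vadd_left_invol)

lemma card_image_vadd [simp]: "card (vadd u ` S) = card S"
  by (rule card_image[OF inj_on_vadd])

lemma mem_image_vadd_iff: "v \<in> vadd u ` S \<longleftrightarrow> vadd u v \<in> S"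
  by (metis imageE imageI vadd_left_invol)

definition subspaces :: "nat \<Rightarrow> (nat \<Rightarrow> bool) set set" where
  "subspaces k = {S. S \<subseteq> Wsp k \<and> vzero \<in> S \<and> (\<forall>u\<in>S. \<forall>v\<in>S. vadd u v \<in> S)}"

lemma subspacesD:
  assumes "S \<in> subspaces k"
  shows "S \<subseteq> Wsp k" "vzero \<in> S" "\<And>u v. u \<in> S \<Longrightarrow> v \<in> S \<Longrightarrow> vadd u v \<in> S"
  using assms by (auto simp: subspaces_def)

lemma subspaces_vadd_iff:
  assumes "S \<in> subspaces k" "u \<in> S"
  shows "vadd u v \<in> S \<longleftrightarrow> v \<in> S" and "vadd v u \<in> S \<longleftrightarrow> v \<in> S"
proof -
  show "vadd u v \<in> S \<longleftrightarrow> v \<in> S"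
    using subspacesD(3)[OF assms] by (metis vadd_left_invol)
  then show "vadd v u \<in> S \<longleftrightarrow> v \<in> S" by (simp add: vadd.commute)
qed

lemma Wsp_in_subspaces: "Wsp k \<in> subspaces k"
  by (auto simp: subspaces_def Wsp_def vadd_def)

lemmas vadd_in_Wsp = subspacesD(3)[OF Wsp_in_subspaces]

lemma line_in_subspaces: "b \<in> Wsp k \<Longrightarrow> {vzero, b} \<in> subspaces k"
  by (auto simp: subspaces_def Wsp_def)

lemma Int_in_subspaces: "S \<in> subspaces k \<Longrightarrow> T \<in> subspaces k \<Longrightarrow> S \<inter> T \<in> subspaces k"
  by (auto simp: subspaces_def)

lemma Un_coset_in_subspaces:
  assumes S: "S \<in> subspaces k" and w: "w \<in> Wsp k"
  shows "S \<union> vadd w ` S \<in> subspaces k"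
proof -
  have mem: "v \<in> S \<union> vadd w ` S \<longleftrightarrow> v \<in> S \<or> vadd w v \<in> S" for v
    by (simp add: mem_image_vadd_iff)
  have "vadd u v \<in> S \<union> vadd w ` S"
    if u: "u \<in> S \<union> vadd w ` S" and v: "v \<in> S \<union> vadd w ` S" for u v
  proof -
    have "vadd w (vadd u v) = vadd u (vadd w v)" "vadd w (vadd u v) = vadd (vadd w u) v"
      "vadd u v = vadd (vadd w u) (vadd w v)"
      by (auto simp: vadd_def)
    then show ?thesis using u v subspacesD(3)[OF S] unfolding mem by metis
  qed
  moreover have "S \<union> vadd w ` S \<subseteq> Wsp k"
    using subspacesD(1)[OF S] vadd_in_Wsp[OF w] by auto
  ultimately show ?thesis using subspacesD(2)[OF S] by (auto simp: subspaces_def)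
qed

lemma bij_betw_nu: "bij_betw (nu k) {..<2^k} (Wsp k)"
proof (rule bij_betw_byWitness[where f' = "\<lambda>v. horner_sum of_bool (2::nat) (map v [0..<k])"])
  have "map (nu k i) [0..<k] = map (bit i) [0..<k]" for i
    by (auto simp: nu_def)
  then show "\<forall>i\<in>{..<2^k}. horner_sum of_bool (2::nat) (map (nu k i) [0..<k]) = i"
    by (simp only: horner_sum_bit_eq_take_bit) (simp add: take_bit_nat_eq_self)
  show "\<forall>v\<in>Wsp k. nu k (horner_sum of_bool (2::nat) (map v [0..<k])) = v"
  proof (intro ballI ext)
    fix v j assume "v \<in> Wsp k"
    then show "nu k (horner_sum of_bool (2::nat) (map v [0..<k])) j = v j"
      by (cases "j < k") (auto simp: nu_def bit_horner_sum_bit_iff Wsp_def)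
  qed
  show "(\<lambda>v. horner_sum of_bool (2::nat) (map v [0..<k])) ` Wsp k \<subseteq> {..<2^k}"
    using horner_sum_bound[of "map _ [0..<k]", where ?'a = nat] by auto
qed (auto simp: nu_def Wsp_def)

lemma finite_Wsp [simp]: "finite (Wsp k)"
  using bij_betw_finite[OF bij_betw_nu] by simp

lemma card_Wsp: "card (Wsp k) = 2^k"
  using bij_betw_same_card[OF bij_betw_nu] by simp

lemma finite_subspaces [simp]: "finite (subspaces k)"
  by (rule finite_subset[of _ "Pow (Wsp k)"]) (auto simp: subspaces_def)

lemma finite_subspace: "S \<in> subspaces k \<Longrightarrow> finite S"
  using finite_subset[OF subspacesD(1)] by simp

lemma subspace_Int_complement: "S \<in> subspaces k \<Longrightarrow> S \<inter> (Wsp k - P) = S - P"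
  using subspacesD(1) by auto

section \<open>Spans and dimension\<close>

lemma f2sum_empty [simp]: "f2sum {} = vzero"
  by (simp add: f2sum_def)

lemma f2sum_insert:
  assumes "finite T" "v \<notin> T"
  shows "f2sum (insert v T) = vadd v (f2sum T)"
proof
  fix j
  have "{u \<in> insert v T. u j} = (if v j then insert v {u \<in> T. u j} else {u \<in> T. u j})" by auto
  then show "f2sum (insert v T) j = vadd v (f2sum T) j"
    using assms by (auto simp: f2sum_def vadd_def)
qed

lemma f2sum_in_subspace:
  assumes "S \<in> subspaces k" "finite T" "T \<subseteq> S"
  shows "f2sum T \<in> S"
  using assms(2,3) by (induction T rule: finite_induct)
    (auto simp: f2sum_insert subspacesD[OF assms(1)])

lemma f2sum_sym_diff:
  assumes "finite T" "finite U"
  shows "f2sum (sym_diff T U) = vadd (f2sum T) (f2sum U)"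
proof
  fix j
  let ?T = "{v\<in>T. v j}" and ?U = "{v\<in>U. v j}"
  have "card {v \<in> sym_diff T U. v j} + 2 * card (?T \<inter> ?U) = card ?T + card ?U"
  proof -
    have "{v \<in> sym_diff T U. v j} = (?T - ?U) \<union> (?U - ?T)" by auto
    then have "card {v \<in> sym_diff T U. v j} = card (?T - ?U) + card (?U - ?T)"
      using assms by (subst card_Un_disjoint[symmetric]) auto
    moreover have "card ?T = card (?T - ?U) + card (?T \<inter> ?U)"
      "card ?U = card (?U - ?T) + card (?T \<inter> ?U)"
      using assms card_Int_Diff[of ?T ?U] card_Int_Diff[of ?U ?T] by (simp_all add: Int_commute)
    ultimately show ?thesis by simp
  qed
  from arg_cong[OF this, of odd] show "f2sum (sym_diff T U) j = vadd (f2sum T) (f2sum U) j"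
    by (simp add: f2sum_def vadd_def)
qed

lemma f2sum_in_f2span: "T \<subseteq> B \<Longrightarrow> f2sum T \<in> f2span B"
  by (auto simp: f2span_def)

lemma superset_f2span: "B \<subseteq> f2span B"
proof
  fix v assume "v \<in> B"
  then show "v \<in> f2span B"
    using f2sum_in_f2span[of "{v}" B] f2sum_insert[of "{}" v] by simp
qed

lemma f2span_in_subspaces:
  assumes "B \<subseteq> Wsp k"
  shows "f2span B \<in> subspaces k"
proof -
  have fin: "finite T" if "T \<subseteq> B" for T
    using finite_subset[OF that finite_subset[OF assms finite_Wsp]] .
  have "f2sum T \<in> Wsp k" if "T \<subseteq> B" for T
    using f2sum_in_subspace[OF Wsp_in_subspaces fin[OF that]] that assms by blast
  moreover have "vzero \<in> f2span B"
    using f2sum_in_f2span[of "{}"] by simp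
  moreover have "vadd (f2sum T) (f2sum U) \<in> f2span B" if "T \<subseteq> B" "U \<subseteq> B" for T U
  proof -
    have "sym_diff T U \<subseteq> B" using that by auto
    then show ?thesis
      using f2sum_in_f2span[of "sym_diff T U" B] fin that by (simp add: f2sum_sym_diff)
  qed
  ultimately show ?thesis by (auto simp: subspaces_def f2span_def)
qed

lemma card_f2span:
  assumes "f2indep B"
  shows "card (f2span B) = 2 ^ card B"
proof -
  have fin: "finite B" using assms by (simp add: f2indep_def)
  have "inj_on f2sum (Pow B)"
  proof (rule inj_onI)
    fix T U assume TU: "T \<in> Pow B" "U \<in> Pow B" "f2sum T = f2sum U"
    then have "finite T" "finite U" using fin finite_subset by auto
    then have "f2sum (sym_diff T U) = vzero" using TU(3) by (simp add: f2sum_sym_diff)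
    moreover have "sym_diff T U \<subseteq> B" using TU by auto
    ultimately have "sym_diff T U = {}" using assms unfolding f2indep_def by blast
    then show "T = U" by blast
  qed
  moreover have "f2span B = f2sum ` Pow B" by (auto simp: f2span_def)
  ultimately show ?thesis using fin by (simp add: card_image card_Pow)
qed

lemma f2indep_insert:
  assumes B: "f2indep B" and v: "v \<notin> f2span B"
  shows "f2indep (insert v B)"
  unfolding f2indep_def
proof (intro conjI allI impI)
  show "finite (insert v B)" using B by (simp add: f2indep_def)
  fix T assume T: "T \<subseteq> insert v B" "f2sum T = vzero"
  have "v \<notin> T"
  proof
    assume "v \<in> T"
    moreover have sub: "T - {v} \<subseteq> B" using T(1) by auto
    moreover have "finite (T - {v})" using finite_subset[OF sub] B by (simp add: f2indep_def)
    ultimately have "vadd v (f2sum (T - {v})) = vzero"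
      using T(2) f2sum_insert[of "T - {v}" v] by (simp add: insert_absorb)
    then have "v = f2sum (T - {v})" by simp
    then show False using v f2sum_in_f2span[OF sub] by simp
  qed
  then have "T \<subseteq> B" using T(1) by auto
  then show "T = {}" using T(2) B unfolding f2indep_def by blast
qed

lemma subspace_has_basis:
  assumes S: "S \<in> subspaces k"
  obtains B where "B \<subseteq> S" "f2indep B" "S = f2span B"
proof -
  let ?I = "{B. B \<subseteq> S \<and> f2indep B}"
  have "finite ?I" using finite_subspace[OF S] by simp
  moreover have "?I \<noteq> {}" by (auto simp: f2indep_def intro!: exI[of _ "{}"])
  ultimately obtain B where B: "B \<subseteq> S" "f2indep B"
    and maximal: "\<And>C. C \<subseteq> S \<Longrightarrow> f2indep C \<Longrightarrow> B \<subseteq> C \<Longrightarrow> B = C"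
    using finite_has_maximal[of ?I] by auto
  have "f2span B \<subseteq> S"
    using f2sum_in_subspace[OF S] B(1) finite_subset[OF _ finite_subspace[OF S]]
    by (auto simp: f2span_def)
  moreover have "v \<in> f2span B" if "v \<in> S" for v
  proof (rule ccontr)
    assume v: "v \<notin> f2span B"
    have "B = insert v B"
      by (rule maximal[OF _ f2indep_insert[OF B(2) v]]) (use B(1) that in auto)
    then show False using v superset_f2span[of B] by auto
  qed
  ultimately show thesis using that[OF B] by blast
qed

lemma Xi_eq: "Xi k d = {S \<in> subspaces k. card S = 2^d}"
proof (intro equalityI subsetI)
  fix S assume "S \<in> Xi k d"
  then show "S \<in> {S \<in> subspaces k. card S = 2^d}"
    by (auto simp: Xi_def card_f2span f2span_in_subspaces)
next
  fix S assume S: "S \<in> {S \<in> subspaces k. card S = 2^d}"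
  then obtain B where B: "B \<subseteq> S" "f2indep B" "S = f2span B"
    using subspace_has_basis by blast
  moreover have "card B = d" using B S card_f2span by fastforce
  ultimately show "S \<in> Xi k d" using S subspacesD(1) unfolding Xi_def by blast
qed

definition codim :: "nat \<Rightarrow> (nat \<Rightarrow> bool) set \<Rightarrow> nat" where
  "codim k S = (THE d. 2^d * card S = 2^k)"

lemma codim_eqI:
  assumes "2^d * card S = 2^k"
  shows "codim k S = d"
  unfolding codim_def
proof (rule the_equality)
  show "2^d * card S = 2^k" by (rule assms)
next
  fix e assume "2^e * card S = 2^k"
  then have "2^e * card S = 2^d * card S" using assms by simp
  moreover have "card S \<noteq> 0" using assms by (metis mult_0_right power_not_zero zero_neq_numeral)
  ultimately show "e = d" by simp
qed

lemma card_mult_codim: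
  assumes S: "S \<in> subspaces k"
  shows "2^codim k S * card S = 2^k"
proof -
  obtain B where "f2indep B" "S = f2span B" using subspace_has_basis[OF S] by blast
  then have B: "card S = 2^card B" using card_f2span by blast
  have "card S \<le> 2^k" using card_mono[OF finite_Wsp subspacesD(1)[OF S]] by (simp add: card_Wsp)
  then have "card B \<le> k" unfolding B by simp
  then have "2^(k - card B) * card S = 2^k" by (simp add: B flip: power_add)
  then show ?thesis using codim_eqI by metis
qed

lemma codim_Wsp: "codim k (Wsp k) = 0"
  by (intro codim_eqI) (simp add: card_Wsp)

lemma codim_eq_0_iff:
  assumes "S \<in> subspaces k"
  shows "codim k S = 0 \<longleftrightarrow> S = Wsp k"
proof
  assume "codim k S = 0"
  then have "card S = card (Wsp k)" using card_mult_codim[OF assms] by (simp add: card_Wsp)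
  then show "S = Wsp k" using subspacesD(1)[OF assms] card_subset_eq finite_Wsp by blast
qed (simp add: codim_Wsp)

lemma codim_le:
  assumes "S \<in> subspaces k"
  shows "codim k S \<le> k"
proof (rule power_dvd_imp_le)
  show "(2::nat)^codim k S dvd 2^k"
    using card_mult_codim[OF assms] by (metis dvd_triv_left)
qed simp

definition subspace_weight :: "nat \<Rightarrow> (nat \<Rightarrow> bool) set \<Rightarrow> real" where
  "subspace_weight k S = Kc (codim k S)"

lemma sum_Xi:
  "(\<Sum>d=1..k. Kc d * (\<Sum>S\<in>Xi k (k - d). g S))
    = (\<Sum>S\<in>subspaces k - {Wsp k}. subspace_weight k S * g S)"
proof -
  let ?proper = "subspaces k - {Wsp k}"
  have Xi: "Xi k (k - d) = {S \<in> ?proper. codim k S = d}" if "d \<in> {1..k}" for d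
  proof -
    have "card S = 2^(k - d) \<longleftrightarrow> codim k S = d" if S: "S \<in> subspaces k" for S
    proof -
      have "(2::nat)^k = 2^d * 2^(k - d)" using \<open>d \<in> {1..k}\<close> by (simp flip: power_add)
      then show ?thesis using card_mult_codim[OF S] codim_eqI[of d S k] by fastforce
    qed
    then show ?thesis using that by (auto simp: Xi_eq codim_Wsp)
  qed
  have "(\<Sum>d=1..k. Kc d * (\<Sum>S\<in>Xi k (k - d). g S))
      = (\<Sum>d=1..k. \<Sum>S\<in>{S \<in> ?proper. codim k S = d}. subspace_weight k S * g S)"
    by (intro sum.cong refl) (simp add: Xi sum_distrib_left subspace_weight_def)
  also have "\<dots> = (\<Sum>S\<in>?proper. subspace_weight k S * g S)"
  proof (rule sum.group)
    show "codim k ` ?proper \<subseteq> {1..k}"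
      by (auto simp: codim_le Suc_le_eq codim_eq_0_iff)
  qed auto
  finally show ?thesis .
qed

section \<open>Hyperplanes\<close>

definition hyperplanes :: "nat \<Rightarrow> (nat \<Rightarrow> bool) set set" where
  "hyperplanes k = {P \<in> subspaces k. P \<noteq> Wsp k \<and> (\<forall>u\<in>Wsp k - P. \<forall>v\<in>Wsp k - P. vadd u v \<in> P)}"

lemma hyperplanesD:
  assumes "P \<in> hyperplanes k"
  shows "P \<in> subspaces k" "P \<subseteq> Wsp k" "vzero \<in> P" "finite P"
  using assms subspacesD finite_subspace by (auto simp: hyperplanes_def)

lemma hyperplane_vadd_iff:
  assumes P: "P \<in> hyperplanes k" and uv: "u \<in> Wsp k" "v \<in> Wsp k"
  shows "vadd u v \<in> P \<longleftrightarrow> (u \<in> P \<longleftrightarrow> v \<in> P)"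
proof (cases "u \<in> P \<or> v \<in> P")
  case True
  then show ?thesis using subspaces_vadd_iff[OF hyperplanesD(1)[OF P]] by blast
next
  case False
  then show ?thesis using P uv by (auto simp: hyperplanes_def)
qed

lemma complement_hyperplane_nonempty:
  assumes "P \<in> hyperplanes k"
  obtains a where "a \<in> Wsp k - P"
  using assms hyperplanesD(2)[OF assms] by (auto simp: hyperplanes_def)

lemma subspace_Diff_hyperplane:
  assumes P: "P \<in> hyperplanes k" and S: "S \<in> subspaces k" and a: "a \<in> S - P"
  shows "S - P = vadd a ` (S \<inter> P)"
proof -
  have "vadd a v \<in> P \<longleftrightarrow> v \<notin> P" if "v \<in> S" for v
    using hyperplane_vadd_iff[OF P, of a v] subspacesD(1)[OF S] a that by auto
  moreover have "vadd a v \<in> S \<longleftrightarrow> v \<in> S" for v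
    using subspaces_vadd_iff(1)[OF S, of a v] a by simp
  ultimately show ?thesis by (auto simp: mem_image_vadd_iff)
qed

lemma card_Diff_hyperplane:
  assumes "P \<in> hyperplanes k" "S \<in> subspaces k" "\<not> S \<subseteq> P"
  shows "card (S - P) = card (S \<inter> P)"
proof -
  obtain a where "a \<in> S - P" using assms(3) by auto
  then show ?thesis using subspace_Diff_hyperplane[OF assms(1,2)] by simp
qed

lemma card_complement_hyperplane:
  assumes "P \<in> hyperplanes k"
  shows "card (Wsp k - P) = card P"
  using card_Diff_hyperplane[OF assms Wsp_in_subspaces] hyperplanesD(2)[OF assms]
    complement_hyperplane_nonempty[OF assms] by (metis Diff_iff inf.absorb2 subsetD)

lemma card_hyperplane:
  assumes "P \<in> hyperplanes k"
  shows "2 * card P = 2^k"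
  using card_complement_hyperplane[OF assms] hyperplanesD(2)[OF assms]
    card_Int_Diff[OF finite_Wsp, of k P] by (simp add: card_Wsp inf.absorb2)

lemma card_hyperplane_pos:
  assumes "P \<in> hyperplanes k"
  shows "real (card P) > 0"
  using hyperplanesD(3,4)[OF assms] by (auto simp: card_gt_0_iff)

lemma sum_Wsp_hyperplane:
  assumes "P \<in> hyperplanes k"
  shows "sum f (Wsp k) = sum f P + sum f (Wsp k - P)"
  using sum.Int_Diff[of "Wsp k" f P] hyperplanesD(2)[OF assms] by (simp add: inf.absorb2)

lemma separating_hyperplane:
  assumes V: "V \<in> subspaces k" and h: "h \<in> Wsp k" "h \<notin> V"
  obtains P where "P \<in> hyperplanes k" "V \<subseteq> P" "h \<notin> P"
proof -
  let ?I = "{P \<in> subspaces k. V \<subseteq> P \<and> h \<notin> P}"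
  have "finite ?I" "?I \<noteq> {}" using V h by auto
  then obtain P where P: "P \<in> subspaces k" "V \<subseteq> P" "h \<notin> P"
    and maximal: "\<And>Q. Q \<in> subspaces k \<Longrightarrow> V \<subseteq> Q \<Longrightarrow> h \<notin> Q \<Longrightarrow> P \<subseteq> Q \<Longrightarrow> P = Q"
    using finite_has_maximal[of ?I] by auto
  have coset: "vadd h w \<in> P" if w: "w \<in> Wsp k - P" for w
  proof -
    let ?Q = "P \<union> vadd w ` P"
    have Q: "?Q \<in> subspaces k" using Un_coset_in_subspaces[OF P(1)] w by auto
    have "w \<in> ?Q" using subspacesD(2)[OF P(1)] by (simp add: mem_image_vadd_iff)
    then have "P \<noteq> ?Q" using w by auto
    then have "h \<in> ?Q" using maximal[OF Q] P(2) by blast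
    then show ?thesis using P(3) by (simp add: mem_image_vadd_iff vadd.commute[of w h])
  qed
  have "vadd u v \<in> P" if "u \<in> Wsp k - P" "v \<in> Wsp k - P" for u v
  proof -
    have "vadd u v = vadd (vadd h u) (vadd h v)" by (auto simp: vadd_def)
    then show ?thesis using subspacesD(3)[OF P(1) coset coset] that by simp
  qed
  then have "P \<in> hyperplanes k" using P h by (auto simp: hyperplanes_def)
  then show thesis using that P by blast
qed

section \<open>Subspaces avoiding a vector\<close>

definition avoiding :: "nat \<Rightarrow> (nat \<Rightarrow> bool) \<Rightarrow> (nat \<Rightarrow> bool) set set" where
  "avoiding k h = {S \<in> subspaces k. h \<notin> S}"

lemma finite_avoiding [simp]: "finite (avoiding k h)"
  by (simp add: avoiding_def)

lemma Kc_recurrence: "Kc (Suc d) + (2^d - 1) * Kc d = of_bool (d = 0)"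
proof (cases d)
  case (Suc e)
  then have "Kc (Suc d) = Kc d * (1 - 2^d)"
    unfolding Kc_def by (subst prod.atLeastLessThan_Suc) auto
  then show ?thesis using Suc by (simp add: algebra_simps)
qed (simp add: Kc_def)

definition lifts ::
    "nat \<Rightarrow> (nat \<Rightarrow> bool) set \<Rightarrow> (nat \<Rightarrow> bool) \<Rightarrow> (nat \<Rightarrow> bool) set \<Rightarrow> (nat \<Rightarrow> bool) set set" where
  "lifts k P h R = {S \<in> avoiding k h. S \<inter> P = R \<and> \<not> S \<subseteq> P}"

lemma liftsD:
  assumes "S \<in> lifts k P h R"
  shows "S \<in> subspaces k" "h \<notin> S" "S \<inter> P = R" "\<not> S \<subseteq> P"
  using assms by (auto simp: lifts_def avoiding_def)

lemma UN_lifts: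
  assumes P: "P \<in> hyperplanes k" and h: "h \<in> Wsp k - P" and R: "R \<in> subspaces k" "R \<subseteq> P"
  shows "(\<Union>S\<in>lifts k P h R. S - P) = Wsp k - P - vadd h ` R"
proof (intro equalityI subsetI)
  fix u assume "u \<in> (\<Union>S\<in>lifts k P h R. S - P)"
  then obtain S where S: "S \<in> lifts k P h R" "u \<in> S - P" by auto
  then have "vadd h u \<notin> R"
    using liftsD[OF S(1)] subspaces_vadd_iff(2)[OF liftsD(1)[OF S(1)], of u h] by auto
  then show "u \<in> Wsp k - P - vadd h ` R"
    using S subspacesD(1)[OF liftsD(1)[OF S(1)]] by (auto simp: mem_image_vadd_iff)
next
  fix w assume w: "w \<in> Wsp k - P - vadd h ` R"
  let ?S = "R \<union> vadd w ` R"
  have "?S \<in> subspaces k" using Un_coset_in_subspaces[OF R(1)] w by auto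
  moreover have "h \<notin> ?S" using h R w by (auto simp: mem_image_vadd_iff vadd.commute[of w h])
  moreover have "?S \<inter> P = R"
    using R w subspaces_vadd_iff(2)[OF hyperplanesD(1)[OF P], of _ w] by auto
  moreover have mem: "w \<in> ?S - P"
    using w subspacesD(2)[OF R(1)] by (simp add: mem_image_vadd_iff)
  ultimately have "?S \<in> lifts k P h R" by (auto simp: lifts_def avoiding_def)
  then show "w \<in> (\<Union>S\<in>lifts k P h R. S - P)" using mem by blast
qed

lemma card_lifts:
  assumes P: "P \<in> hyperplanes k" and h: "h \<in> Wsp k - P" and R: "R \<in> subspaces k" "R \<subseteq> P"
  shows "(card (lifts k P h R) + 1) * card R = card P"
proof -
  have fin: "finite R" using finite_subspace[OF R(1)] .
  have disjoint: "S = T"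
    if "S \<in> lifts k P h R" "T \<in> lifts k P h R" "u \<in> S - P" "u \<in> T - P" for S T u
  proof -
    have "S - P = T - P"
      using subspace_Diff_hyperplane[OF P liftsD(1)] liftsD(3) that by metis
    moreover have "S \<inter> P = T \<inter> P" using liftsD(3) that(1,2) by metis
    ultimately show ?thesis by blast
  qed
  have "vadd h ` R \<subseteq> Wsp k - P"
  proof
    fix u assume "u \<in> vadd h ` R"
    then obtain r where "u = vadd h r" "r \<in> P" "r \<in> Wsp k"
      using R hyperplanesD(2)[OF P] by auto
    then show "u \<in> Wsp k - P" using h hyperplane_vadd_iff[OF P] vadd_in_Wsp by auto
  qed
  then have "card (Wsp k - P - vadd h ` R) = card P - card R"
    using fin by (simp add: card_Diff_subset card_complement_hyperplane[OF P])
  moreover have "card (\<Union>S\<in>lifts k P h R. S - P) = (\<Sum>S\<in>lifts k P h R. card (S - P))"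
  proof (rule card_UN_disjoint)
    show "finite (lifts k P h R)" by (simp add: lifts_def)
    show "\<forall>S\<in>lifts k P h R. finite (S - P)" using finite_subspace liftsD(1) by blast
  qed (use disjoint in blast)
  moreover have "\<dots> = card (lifts k P h R) * card R"
    using card_Diff_hyperplane[OF P] liftsD by simp
  ultimately have "card (lifts k P h R) * card R = card P - card R"
    unfolding UN_lifts[OF P h R] by simp
  moreover have "card R \<le> card P" using card_mono[OF hyperplanesD(4)[OF P] R(2)] .
  ultimately show ?thesis by simp
qed

lemma sum_subspace_weight_fibre:
  assumes P: "P \<in> hyperplanes k" and h: "h \<in> Wsp k - P" and R: "R \<in> subspaces k" "R \<subseteq> P"
  shows "(\<Sum>S | S \<in> avoiding k h \<and> S \<inter> P = R. subspace_weight k S) = of_bool (R = P)"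
proof -
  note finP = hyperplanesD(4)[OF P]
  have R_pos: "card R > 0"
    using finite_subspace[OF R(1)] subspacesD(2)[OF R(1)] by (auto simp: card_gt_0_iff)
  have codim_R: "2^codim k R * card R = 2 * card P"
    using card_mult_codim[OF R(1)] card_hyperplane[OF P] by simp
  moreover have "card R \<le> card P" using card_mono[OF finP R(2)] .
  ultimately have "codim k R \<noteq> 0" using R_pos by (intro notI) simp
  then obtain d where d: "codim k R = Suc d" by (cases "codim k R") auto
  have card_P: "2^d * card R = card P" using codim_R d by simp
  then have "card (lifts k P h R) + 1 = 2^d"
    using card_lifts[OF P h R] R_pos by (metis mult_right_cancel less_not_refl)
  then have card_L: "real (card (lifts k P h R)) = 2^d - 1"
    by (metis add_diff_cancel_right' of_nat_1 of_nat_add of_nat_numeral of_nat_power)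
  have "subspace_weight k S = Kc d" if "S \<in> lifts k P h R" for S
  proof -
    note S = liftsD[OF that]
    have "card S = 2 * card R"
      using card_Diff_hyperplane[OF P S(1,4)] card_Int_Diff[OF finite_subspace[OF S(1)], of P] S(3)
      by simp
    then have "codim k S = d"
      using card_P card_hyperplane[OF P] by (intro codim_eqI) simp
    then show ?thesis by (simp add: subspace_weight_def)
  qed
  moreover have "{S. S \<in> avoiding k h \<and> S \<inter> P = R} = insert R (lifts k P h R)"
    using R h by (auto simp: lifts_def avoiding_def)
  moreover have "R \<notin> lifts k P h R" "finite (lifts k P h R)"
    using R(2) by (auto simp: lifts_def)
  ultimately have "(\<Sum>S | S \<in> avoiding k h \<and> S \<inter> P = R. subspace_weight k S)
      = Kc (Suc d) + (2^d - 1) * Kc d"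
    by (simp add: card_L d subspace_weight_def)
  also have "\<dots> = of_bool (R = P)"
    unfolding Kc_recurrence using card_P R_pos card_subset_eq[OF finP R(2)] by auto
  finally show ?thesis .
qed

text \<open>Grouping the subspaces by their trace on the hyperplane \<open>P\<close>, every trace except \<open>P\<close> itself
  cancels.\<close>

lemma sum_avoiding_Int_hyperplane:
  fixes \<phi> :: "(nat \<Rightarrow> bool) set \<Rightarrow> real"
  assumes P: "P \<in> hyperplanes k" and h: "h \<in> Wsp k - P"
  shows "(\<Sum>S\<in>avoiding k h. subspace_weight k S * \<phi> (S \<inter> P)) = \<phi> P"
proof -
  let ?T = "{R \<in> subspaces k. R \<subseteq> P}"
  have "(\<Sum>S\<in>avoiding k h. subspace_weight k S * \<phi> (S \<inter> P))
      = (\<Sum>R\<in>?T. \<Sum>S | S \<in> avoiding k h \<and> S \<inter> P = R. subspace_weight k S * \<phi> (S \<inter> P))"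
    by (rule sum.group[symmetric])
      (use hyperplanesD(1)[OF P] in \<open>auto simp: avoiding_def intro: Int_in_subspaces\<close>)
  also have "\<dots> = (\<Sum>R\<in>?T. of_bool (R = P) * \<phi> R)"
    by (intro sum.cong refl)
      (auto simp: sum_subspace_weight_fibre[OF P h] simp flip: sum_distrib_right)
  also have "\<dots> = (\<Sum>R\<in>{P}. \<phi> R)"
    by (rule sum.mono_neutral_cong_right) (use hyperplanesD(1)[OF P] in auto)
  finally show ?thesis by simp
qed

lemma sum_avoiding_superset:
  assumes h: "h \<in> Wsp k"
  shows "(\<Sum>S\<in>avoiding k h. subspace_weight k S * of_bool (T \<subseteq> S))
    = of_bool (\<exists>V\<in>avoiding k h. T \<subseteq> V)"
proof (cases "\<exists>V\<in>avoiding k h. T \<subseteq> V")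
  case True
  then obtain V where "V \<in> subspaces k" "T \<subseteq> V" "h \<notin> V" by (auto simp: avoiding_def)
  then obtain P where P: "P \<in> hyperplanes k" "T \<subseteq> P" "h \<notin> P"
    using separating_hyperplane h by (metis subset_trans)
  then show ?thesis
    using sum_avoiding_Int_hyperplane[OF P(1), of h "\<lambda>R. of_bool (T \<subseteq> R)"] h True by simp
next
  case False
  then have "(\<Sum>S\<in>avoiding k h. subspace_weight k S * of_bool (T \<subseteq> S)) = 0"
    by (intro sum.neutral) auto
  then show ?thesis using False by simp
qed

lemma sum_avoiding_singleton:
  assumes "h \<in> Wsp k" "h \<noteq> vzero" "b \<in> Wsp k"
  shows "(\<Sum>S\<in>avoiding k h. subspace_weight k S * of_bool (b \<in> S)) = of_bool (b \<noteq> h)"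
proof -
  have "(\<exists>V\<in>avoiding k h. {b} \<subseteq> V) \<longleftrightarrow> b \<noteq> h"
    using line_in_subspaces[OF assms(3)] assms(2)
    by (auto simp: avoiding_def intro!: bexI[of _ "{vzero, b}"])
  then show ?thesis using sum_avoiding_superset[OF assms(1), of "{b}"] by simp
qed

lemma sum_avoiding_card:
  assumes "h \<in> Wsp k" "h \<noteq> vzero" "B \<subseteq> Wsp k"
  shows "(\<Sum>S\<in>avoiding k h. subspace_weight k S * real (card (S \<inter> B))) = real (card (B - {h}))"
proof -
  have fin: "finite B" using finite_subset[OF assms(3) finite_Wsp] .
  have card: "real (card (S \<inter> B)) = (\<Sum>b\<in>B. of_bool (b \<in> S))" for S
    using fin by (simp add: Int_commute)
  have "(\<Sum>S\<in>avoiding k h. subspace_weight k S * real (card (S \<inter> B)))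
      = (\<Sum>b\<in>B. \<Sum>S\<in>avoiding k h. subspace_weight k S * of_bool (b \<in> S))"
    unfolding card sum_distrib_left by (rule sum.swap)
  also have "\<dots> = (\<Sum>b\<in>B. of_bool (b \<noteq> h))"
    using assms by (intro sum.cong refl sum_avoiding_singleton) auto
  also have "\<dots> = real (card (B \<inter> {b. b \<noteq> h}))" using fin by simp
  also have "B \<inter> {b. b \<noteq> h} = B - {h}" by auto
  finally show ?thesis .
qed

lemma moment_avoiding:
  assumes h: "h \<in> Wsp k" and B: "finite B"
  shows "(\<Sum>S\<in>avoiding k h. subspace_weight k S * real (card (S \<inter> B)) ^ n)
    = card {xs. set xs \<subseteq> B \<and> length xs = n \<and> (\<exists>V\<in>avoiding k h. set xs \<subseteq> V)}"
proof -
  let ?L = "{xs. set xs \<subseteq> B \<and> length xs = n}"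
  have fin: "finite ?L" using B by (rule finite_lists_length_eq)
  have pow: "real (card (S \<inter> B)) ^ n = (\<Sum>xs\<in>?L. of_bool (set xs \<subseteq> S))" for S
  proof -
    have "card (S \<inter> B) ^ n = card {xs. set xs \<subseteq> S \<inter> B \<and> length xs = n}"
      using card_lists_length_eq[of "S \<inter> B" n] B by simp
    also have "{xs. set xs \<subseteq> S \<inter> B \<and> length xs = n} = ?L \<inter> {xs. set xs \<subseteq> S}" by auto
    finally show ?thesis using fin by (simp flip: of_nat_power)
  qed
  have "(\<Sum>S\<in>avoiding k h. subspace_weight k S * real (card (S \<inter> B)) ^ n)
      = (\<Sum>xs\<in>?L. \<Sum>S\<in>avoiding k h. subspace_weight k S * of_bool (set xs \<subseteq> S))"
    unfolding pow sum_distrib_left by (rule sum.swap)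
  also have "\<dots> = (\<Sum>xs\<in>?L. of_bool (\<exists>V\<in>avoiding k h. set xs \<subseteq> V))"
    unfolding sum_avoiding_superset[OF h] ..
  also have "\<dots> = card (?L \<inter> {xs. \<exists>V\<in>avoiding k h. set xs \<subseteq> V})" using fin by simp
  also have "?L \<inter> {xs. \<exists>V\<in>avoiding k h. set xs \<subseteq> V}
      = {xs. set xs \<subseteq> B \<and> length xs = n \<and> (\<exists>V\<in>avoiding k h. set xs \<subseteq> V)}" by auto
  finally show ?thesis .
qed

lemma sums_minus_one_times_exp:
  fixes t :: real
  shows "(\<lambda>n. (real n - 1) * (t ^ n / fact n)) sums ((t - 1) * exp t)"
proof -
  have exp: "(\<lambda>n. t ^ n / fact n) sums exp t"
    using exp_converges[of t] by (simp add: field_simps)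
  have "(\<lambda>n. t * (t ^ n / fact n)) sums (t * exp t)" using exp by (rule sums_mult)
  then have "(\<lambda>n. real (Suc n) * (t ^ Suc n / fact (Suc n))) sums (t * exp t)"
    by (simp add: field_simps del: of_nat_Suc)
  then have "(\<lambda>n. real n * (t ^ n / fact n)) sums (t * exp t)"
    by (subst (asm) sums_Suc_iff) simp
  from sums_diff[OF this exp] show ?thesis by (simp only: left_diff_distrib mult_1)
qed

text \<open>In the power series of \<open>(t - 1) exp t\<close> the constant term contributes \<open>-1\<close>, the linear
  term vanishes, and all later coefficients become counts of tuples whose span avoids \<open>h\<close>.\<close>

lemma sum_avoiding_minus_one_times_exp_gt:
  assumes h: "h \<in> Wsp k" "h \<noteq> vzero" and B: "finite B"
    and b: "b \<in> B" "b \<in> Wsp k" "b \<noteq> h" and c: "c > 0"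
  shows "(\<Sum>S\<in>avoiding k h. subspace_weight k S
      * ((c * real (card (S \<inter> B)) - 1) * exp (c * real (card (S \<inter> B))))) > -1" (is "?s > -1")
proof -
  let ?L = "\<lambda>n. {xs. set xs \<subseteq> B \<and> length xs = n \<and> (\<exists>V\<in>avoiding k h. set xs \<subseteq> V)}"
  define f where "f n = (real n - 1) * (c ^ n / fact n) * card (?L n)" for n :: nat
  have "(\<Sum>S\<in>avoiding k h. subspace_weight k S
      * ((real n - 1) * ((c * real (card (S \<inter> B))) ^ n / fact n))) = f n" for n
    unfolding f_def moment_avoiding[OF h(1) B, symmetric] sum_distrib_left
    by (intro sum.cong refl) (simp add: power_mult_distrib)
  moreover have "(\<lambda>n. \<Sum>S\<in>avoiding k h. subspace_weight k S
      * ((real n - 1) * ((c * real (card (S \<inter> B))) ^ n / fact n))) sums ?s"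
    by (intro sums_sum sums_mult sums_minus_one_times_exp)
  ultimately have series: "f sums ?s" by simp
  have line: "{vzero, b} \<in> avoiding k h"
    using b h line_in_subspaces by (auto simp: avoiding_def)
  then have mem: "replicate n b \<in> ?L n" for n using b by (auto intro!: bexI[of _ "{vzero, b}"])
  have "?L 0 = {[]}" using mem[of 0] by auto
  then have "f 0 = -1" by (simp add: f_def)
  moreover have "f 1 = 0" by (simp add: f_def)
  moreover have "f 2 > 0"
  proof -
    have "finite (?L 2)"
      by (rule finite_subset[OF _ finite_lists_length_eq[OF B, of 2]]) auto
    moreover have "?L 2 \<noteq> {}" using mem[of 2] by blast
    ultimately have "card (?L 2) > 0" by (simp only: card_gt_0_iff simp_thms)
    then show ?thesis using c unfolding f_def by (intro mult_pos_pos divide_pos_pos) auto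
  qed
  moreover have "f 0 + f 1 + f 2 \<le> ?s"
  proof -
    have "(\<Sum>n<3. f n) \<le> ?s" unfolding sums_unique[OF series]
    proof (rule sum_le_suminf[OF sums_summable[OF series]])
      fix n assume "n \<in> - {..<3::nat}"
      then show "0 \<le> f n" using c by (auto simp: f_def)
    qed simp
    then show ?thesis by (simp add: eval_nat_numeral)
  qed
  ultimately show ?thesis by linarith
qed

section \<open>Weighted codegrees\<close>

definition codegree :: "'a set set \<Rightarrow> ('a set \<Rightarrow> real) \<Rightarrow> 'a set \<Rightarrow> real" where
  "codegree F w I = (\<Sum>S | S \<in> F \<and> I \<subseteq> S. w S)"

lemma codegree_empty [simp]: "codegree F w {} = sum w F"
  by (simp add: codegree_def)

lemma codegree_eq_sum_of_bool:
  "finite F \<Longrightarrow> codegree F w I = (\<Sum>S\<in>F. w S * of_bool (I \<subseteq> S))"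
  unfolding codegree_def by (rule sum.mono_neutral_cong_left) auto

lemma sum_Int_eq_sum_of_bool:
  fixes z :: "'a \<Rightarrow> real"
  shows "finite B \<Longrightarrow> sum z (S \<inter> B) = (\<Sum>v\<in>B. z v * of_bool (v \<in> S))"
  by (rule sum.mono_neutral_cong_left) auto

lemma sum_weighted_sum_Int:
  assumes "finite F" "finite B"
  shows "(\<Sum>S\<in>F. w S * sum z (S \<inter> B)) = (\<Sum>v\<in>B. z v * codegree F w {v})"
proof -
  have "(\<Sum>S\<in>F. w S * sum z (S \<inter> B)) = (\<Sum>S\<in>F. \<Sum>v\<in>B. z v * (w S * of_bool (v \<in> S)))"
    unfolding sum_Int_eq_sum_of_bool[OF assms(2)] sum_distrib_left
    by (intro sum.cong refl) (simp only: mult.left_commute)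
  also have "\<dots> = (\<Sum>v\<in>B. \<Sum>S\<in>F. z v * (w S * of_bool (v \<in> S)))" by (rule sum.swap)
  finally show ?thesis by (simp add: codegree_eq_sum_of_bool[OF assms(1)] sum_distrib_left)
qed

lemma sum_weighted_sum_Int_power2:
  assumes "finite F" "finite B"
  shows "(\<Sum>S\<in>F. w S * (sum z (S \<inter> B))\<^sup>2)
    = (\<Sum>i\<in>B. \<Sum>j\<in>B. z i * z j * codegree F w {i, j})"
proof -
  have square: "(sum z (S \<inter> B))\<^sup>2 = (\<Sum>i\<in>B. \<Sum>j\<in>B. z i * z j * of_bool ({i, j} \<subseteq> S))" for S
    unfolding sum_Int_eq_sum_of_bool[OF assms(2)] power2_eq_square sum_product
    by (intro sum.cong refl) simp
  have "(\<Sum>S\<in>F. w S * (sum z (S \<inter> B))\<^sup>2)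
      = (\<Sum>S\<in>F. \<Sum>i\<in>B. \<Sum>j\<in>B. z i * z j * (w S * of_bool ({i, j} \<subseteq> S)))"
    unfolding square sum_distrib_left by (intro sum.cong refl) (simp only: ac_simps)
  also have "\<dots> = (\<Sum>i\<in>B. \<Sum>S\<in>F. \<Sum>j\<in>B. z i * z j * (w S * of_bool ({i, j} \<subseteq> S)))"
    by (rule sum.swap)
  also have "\<dots> = (\<Sum>i\<in>B. \<Sum>j\<in>B. \<Sum>S\<in>F. z i * z j * (w S * of_bool ({i, j} \<subseteq> S)))"
    by (intro sum.cong refl sum.swap)
  finally show ?thesis by (simp only: codegree_eq_sum_of_bool[OF assms(1)] sum_distrib_left)
qed

lemma quadratic_form_const:
  fixes z :: "'a \<Rightarrow> real"
  assumes "finite B"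
  shows "(\<Sum>i\<in>B. \<Sum>j\<in>B. z i * z j * (d - of_bool (i \<noteq> j) * e))
    = e * (\<Sum>i\<in>B. (z i)\<^sup>2) + (d - e) * (sum z B)\<^sup>2"
proof -
  have "(\<Sum>i\<in>B. \<Sum>j\<in>B. z i * z j * (d - of_bool (i \<noteq> j) * e))
      = (\<Sum>i\<in>B. \<Sum>j\<in>B. (d - e) * (z i * z j) + (if j = i then e * (z i)\<^sup>2 else 0))"
    by (intro sum.cong refl) (auto simp: algebra_simps power2_eq_square)
  also have "\<dots> = (d - e) * (sum z B)\<^sup>2 + e * (\<Sum>i\<in>B. (z i)\<^sup>2)"
    using assms by (simp add: sum.distrib sum_product power2_eq_square flip: sum_distrib_left)
  finally show ?thesis by simp
qed

lemma codegree_subspaces_avoiding: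
  "codegree (subspaces k) w I = codegree (subspaces k) w (insert h I) + codegree (avoiding k h) w I"
  unfolding codegree_def avoiding_def
  by (subst sum.union_disjoint[symmetric]) (auto intro!: sum.cong)

lemma codegree_subspaces_singleton:
  "codegree (subspaces k) w {v} = sum w (subspaces k) - sum w (avoiding k v)"
  using codegree_subspaces_avoiding[of k w "{}" v] by simp

lemma codegree_subspaces_pair:
  "codegree (subspaces k) w {i, j}
    = codegree (subspaces k) w {i} - codegree (avoiding k (vadd i j)) w {i}"
proof -
  have "codegree (avoiding k (vadd i j)) w {i} = codegree (avoiding k j) w {i}"
    unfolding codegree_def avoiding_def using subspaces_vadd_iff(1) by (intro sum.cong refl) blast
  then show ?thesis
    using codegree_subspaces_avoiding[of k w "{i}" j] by (simp add: insert_commute)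
qed

section \<open>Automorphisms preserving a hyperplane\<close>

definition automorphisms :: "nat \<Rightarrow> (nat \<Rightarrow> bool) set \<Rightarrow> ((nat \<Rightarrow> bool) \<Rightarrow> nat \<Rightarrow> bool) set" where
  "automorphisms k H = {t. bij_betw t (Wsp k) (Wsp k)
    \<and> (\<forall>u\<in>Wsp k. \<forall>v\<in>Wsp k. t (vadd u v) = vadd (t u) (t v))
    \<and> (\<forall>v\<in>Wsp k. t v \<in> H \<longleftrightarrow> v \<in> H)}"

lemma automorphismsD:
  assumes "t \<in> automorphisms k H"
  shows "bij_betw t (Wsp k) (Wsp k)" "inj_on t (Wsp k)"
    "\<And>u v. u \<in> Wsp k \<Longrightarrow> v \<in> Wsp k \<Longrightarrow> t (vadd u v) = vadd (t u) (t v)"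
    "\<And>v. v \<in> Wsp k \<Longrightarrow> t v \<in> Wsp k"
    "\<And>v. v \<in> Wsp k \<Longrightarrow> t v \<in> H \<longleftrightarrow> v \<in> H"
  using assms by (auto simp: automorphisms_def bij_betw_def)

lemma automorphism_image_in_subspaces:
  assumes t: "t \<in> automorphisms k H" and S: "S \<in> subspaces k"
  shows "t ` S \<in> subspaces k"
proof -
  note SW = subsetD[OF subspacesD(1)[OF S]]
  have closed: "vadd (t u) (t v) \<in> t ` S" if "u \<in> S" "v \<in> S" for u v
    using automorphismsD(3)[OF t SW SW] subspacesD(3)[OF S] that by (metis imageI)
  moreover have "vzero \<in> t ` S"
    using closed[of vzero vzero] subspacesD(2)[OF S] by simp
  moreover have "t ` S \<subseteq> Wsp k"
    by (intro image_subsetI automorphismsD(4)[OF t] SW)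
  ultimately show ?thesis by (auto simp: subspaces_def)
qed

lemma bij_betw_image_subspaces:
  assumes t: "t \<in> automorphisms k H"
  shows "bij_betw (image t) (subspaces k) (subspaces k)"
proof -
  have "inj_on (image t) (subspaces k)"
    by (rule inj_on_subset[OF inj_on_image_Pow[OF automorphismsD(2)[OF t]]])
      (auto simp: subspaces_def)
  moreover from this have "image t ` subspaces k = subspaces k"
    using automorphism_image_in_subspaces[OF t] by (intro endo_inj_surj) auto
  ultimately show ?thesis by (simp add: bij_betw_def)
qed

lemma automorphism_image_subset_iff:
  assumes "t \<in> automorphisms k H" "S \<in> subspaces k" "I \<subseteq> Wsp k"
  shows "t ` I \<subseteq> t ` S \<longleftrightarrow> I \<subseteq> S"
  by (rule inj_on_image_subset_iff[OF automorphismsD(2)[OF assms(1)] assms(3)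
        subspacesD(1)[OF assms(2)]])

lemma codegree_avoiding_automorphism:
  assumes t: "t \<in> automorphisms k H" and I: "I \<subseteq> Wsp k" and h: "h \<in> Wsp k"
    and w: "\<And>S. S \<in> subspaces k \<Longrightarrow> w (t ` S) = w S"
  shows "codegree (avoiding k (t h)) w (t ` I) = codegree (avoiding k h) w I"
proof -
  note iff = automorphism_image_subset_iff[OF t]
  have "bij_betw (image t) {S. S \<in> avoiding k h \<and> I \<subseteq> S} {S. S \<in> avoiding k (t h) \<and> t ` I \<subseteq> S}"
  proof (rule bij_betw_subset[OF bij_betw_image_subspaces[OF t]])
    show "image t ` {S. S \<in> avoiding k h \<and> I \<subseteq> S} = {S. S \<in> avoiding k (t h) \<and> t ` I \<subseteq> S}"
    proof (intro equalityI subsetI)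
      fix T assume T: "T \<in> {S. S \<in> avoiding k (t h) \<and> t ` I \<subseteq> S}"
      then have "T \<in> image t ` subspaces k"
        using bij_betw_imp_surj_on[OF bij_betw_image_subspaces[OF t]] by (simp add: avoiding_def)
      then obtain S where "S \<in> subspaces k" "T = t ` S" by blast
      then show "T \<in> image t ` {S. S \<in> avoiding k h \<and> I \<subseteq> S}"
        using T iff[OF _ I] by (auto simp: avoiding_def)
    next
      fix T assume "T \<in> image t ` {S. S \<in> avoiding k h \<and> I \<subseteq> S}"
      then show "T \<in> {S. S \<in> avoiding k (t h) \<and> t ` I \<subseteq> S}"
        using iff[of _ "{h}"] h automorphism_image_in_subspaces[OF t] by (auto simp: avoiding_def)
    qed
  qed (auto simp: avoiding_def)
  from sum.reindex_bij_betw[OF this, of w] show ?thesis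
    using w by (simp add: codegree_def avoiding_def)
qed

definition transvection :: "(nat \<Rightarrow> bool) set \<Rightarrow> (nat \<Rightarrow> bool) \<Rightarrow> (nat \<Rightarrow> bool) \<Rightarrow> nat \<Rightarrow> bool" where
  "transvection P w v = (if v \<in> P then v else vadd v w)"

lemma transvection_automorphism:
  assumes P: "P \<in> hyperplanes k" and H: "H \<in> subspaces k" and w: "w \<in> P" "w \<in> H"
  shows "transvection P w \<in> automorphisms k H"
proof -
  let ?t = "transvection P w"
  have W: "w \<in> Wsp k" using w subspacesD(1)[OF H] by auto
  have iff: "vadd v w \<in> P \<longleftrightarrow> v \<in> P" for v
    using subspaces_vadd_iff(2)[OF hyperplanesD(1)[OF P] w(1)] .
  have "?t v \<in> Wsp k" if "v \<in> Wsp k" for v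
    using that W vadd_in_Wsp by (simp add: transvection_def)
  moreover have "?t (?t v) = v" for v
    by (simp add: transvection_def iff)
  ultimately have "bij_betw ?t (Wsp k) (Wsp k)"
    by (intro bij_betw_byWitness[where f' = ?t]) auto
  moreover have "?t (vadd u v) = vadd (?t u) (?t v)" if "u \<in> Wsp k" "v \<in> Wsp k" for u v
    using hyperplane_vadd_iff[OF P that] by (auto simp: transvection_def vadd_def)
  moreover have "?t v \<in> H \<longleftrightarrow> v \<in> H" for v
    using subspaces_vadd_iff(2)[OF H w(2)] by (simp add: transvection_def)
  ultimately show ?thesis by (simp add: automorphisms_def)
qed

lemma automorphism_transitive_complement:
  assumes H: "H \<in> hyperplanes k" and ij: "i \<in> Wsp k - H" "j \<in> Wsp k - H"
  obtains t where "t \<in> automorphisms k H" "t i = j" "\<forall>h\<in>H. t h = h"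
proof (rule that)
  have "vadd i j \<in> H" using hyperplane_vadd_iff[OF H] ij by auto
  then show "transvection H (vadd i j) \<in> automorphisms k H"
    using transvection_automorphism[OF H hyperplanesD(1)[OF H]] by simp
qed (use ij in \<open>auto simp: transvection_def\<close>)

lemma automorphism_transitive_subspace:
  assumes H: "H \<in> subspaces k" and g: "g \<in> H" "g \<noteq> vzero" and h: "h \<in> H" "h \<noteq> vzero"
  obtains t where "t \<in> automorphisms k H" "t g = h"
proof -
  let ?w = "vadd g h"
  have w: "?w \<in> H" using subspacesD(3)[OF H] g h by simp
  have W: "g \<in> Wsp k" "?w \<in> Wsp k" using g w subspacesD(1)[OF H] by auto
  have "g \<noteq> ?w" using h(2) by (metis vadd.right_neutral vadd_left_invol)
  then obtain P where P: "P \<in> hyperplanes k" "{vzero, ?w} \<subseteq> P" "g \<notin> P"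
    using separating_hyperplane[OF line_in_subspaces[OF W(2)] W(1)] g(2) by blast
  then have "transvection P ?w \<in> automorphisms k H"
    using transvection_automorphism[OF P(1) H] w by simp
  moreover have "transvection P ?w g = h" using P(3) by (simp add: transvection_def)
  ultimately show thesis using that by blast
qed

section \<open>Exponentially tilted weights\<close>

definition tilted_weight :: "nat \<Rightarrow> (nat \<Rightarrow> bool) set \<Rightarrow> real \<Rightarrow> (nat \<Rightarrow> bool) set \<Rightarrow> real" where
  "tilted_weight k H c S = subspace_weight k S * exp (c * real (card (S - H)))"

lemma tilted_weight_automorphism:
  assumes t: "t \<in> automorphisms k H" and S: "S \<in> subspaces k"
  shows "tilted_weight k H c (t ` S) = tilted_weight k H c S"
proof -
  note SW = subspacesD(1)[OF S]
  have "card (t ` T) = card T" if "T \<subseteq> S" for T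
    using that SW inj_on_subset[OF automorphismsD(2)[OF t]] by (intro card_image) blast
  moreover have "t ` S - H = t ` (S - H)" using SW automorphismsD(5)[OF t] by auto
  ultimately show ?thesis by (simp add: tilted_weight_def subspace_weight_def codim_def)
qed

lemma codegree_avoiding_tilted_automorphism:
  assumes "t \<in> automorphisms k H" "I \<subseteq> Wsp k" "h \<in> Wsp k"
  shows "codegree (avoiding k (t h)) (tilted_weight k H c) (t ` I)
    = codegree (avoiding k h) (tilted_weight k H c) I"
  by (rule codegree_avoiding_automorphism[OF assms]) (rule tilted_weight_automorphism[OF assms(1)])

definition tilted_curvature ::
    "nat \<Rightarrow> (nat \<Rightarrow> bool) set \<Rightarrow> real \<Rightarrow> (nat \<Rightarrow> bool) \<Rightarrow> (nat \<Rightarrow> bool) \<Rightarrow> real" where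
  "tilted_curvature k H c a h
    = sum (tilted_weight k H c) (avoiding k a) - sum (tilted_weight k H c) (avoiding k h)
      + c * codegree (avoiding k h) (tilted_weight k H c) {a}"

context
  fixes k :: nat and H :: "(nat \<Rightarrow> bool) set" and c :: real
  assumes H: "H \<in> hyperplanes k"
begin

lemma codegree_avoiding_tilted_const:
  assumes i: "i \<in> Wsp k - H" "j \<in> Wsp k - H" and g: "g \<in> H" "g \<noteq> vzero" and h: "h \<in> H" "h \<noteq> vzero"
  shows "codegree (avoiding k g) (tilted_weight k H c) {i}
    = codegree (avoiding k h) (tilted_weight k H c) {j}"
proof -
  have W: "i \<in> Wsp k" "g \<in> Wsp k" "h \<in> Wsp k" using assms hyperplanesD(2)[OF H] by auto
  obtain s where s: "s \<in> automorphisms k H" "s g = h"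
    by (rule automorphism_transitive_subspace[OF hyperplanesD(1)[OF H] g h])
  have si: "s i \<in> Wsp k - H" using automorphismsD(4,5)[OF s(1)] i(1) by auto
  obtain t where t: "t \<in> automorphisms k H" "t (s i) = j" "\<forall>h\<in>H. t h = h"
    by (rule automorphism_transitive_complement[OF H si i(2)])
  show ?thesis
    using codegree_avoiding_tilted_automorphism[OF s(1) _ W(2), of "{i}"]
      codegree_avoiding_tilted_automorphism[OF t(1) _ W(3), of "{s i}"] W(1) si s(2) t(2,3) h(1)
    by simp
qed

lemma sum_avoiding_tilted_const:
  shows "i \<in> Wsp k - H \<Longrightarrow> j \<in> Wsp k - H \<Longrightarrow>
      sum (tilted_weight k H c) (avoiding k i) = sum (tilted_weight k H c) (avoiding k j)"
    and "g \<in> H \<Longrightarrow> g \<noteq> vzero \<Longrightarrow> h \<in> H \<Longrightarrow> h \<noteq> vzero \<Longrightarrow>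
      sum (tilted_weight k H c) (avoiding k g) = sum (tilted_weight k H c) (avoiding k h)"
proof -
  have invariant:
    "sum (tilted_weight k H c) (avoiding k (t v)) = sum (tilted_weight k H c) (avoiding k v)"
    if "t \<in> automorphisms k H" "v \<in> Wsp k" for t v
    using codegree_avoiding_tilted_automorphism[OF that(1) _ that(2), of "{}"] by simp
  show "sum (tilted_weight k H c) (avoiding k i) = sum (tilted_weight k H c) (avoiding k j)"
    if "i \<in> Wsp k - H" "j \<in> Wsp k - H"
    using automorphism_transitive_complement[OF H that] invariant that by (metis DiffD1)
  show "sum (tilted_weight k H c) (avoiding k g) = sum (tilted_weight k H c) (avoiding k h)"
    if "g \<in> H" "g \<noteq> vzero" "h \<in> H" "h \<noteq> vzero"
    using automorphism_transitive_subspace[OF hyperplanesD(1)[OF H] that] invariant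
      hyperplanesD(2)[OF H] that(1) by (metis subsetD)
qed

text \<open>Only subspaces inside \<open>H\<close> contribute; these are not affected by the tilt and avoid any
  point outside \<open>H\<close>.\<close>

lemma sum_tilted_card_diff:
  "(\<Sum>S\<in>subspaces k. tilted_weight k H c S * (real (card (S \<inter> H)) - real (card (S - H)))) = 1"
proof -
  obtain a where a: "a \<in> Wsp k - H" using complement_hyperplane_nonempty[OF H] .
  have aW: "a \<in> Wsp k" "a \<noteq> vzero" using a hyperplanesD(3)[OF H] by auto
  have "card (Wsp k - H) \<noteq> 0" using a by auto
  have balanced: "real (card (S \<inter> H)) - real (card (S - H)) = 0"
    if "S \<in> subspaces k" "\<not> S \<subseteq> H" for S
    using card_Diff_hyperplane[OF H that] by simp
  have untilted: "tilted_weight k H c S = subspace_weight k S" if "S \<subseteq> H" for S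
  proof -
    have "S - H = {}" using that by auto
    then show ?thesis by (simp only: tilted_weight_def) simp
  qed
  have "(\<Sum>S\<in>subspaces k. tilted_weight k H c S * (real (card (S \<inter> H)) - real (card (S - H))))
      = (\<Sum>S\<in>avoiding k a. subspace_weight k S * (real (card (S \<inter> H)) - real (card (S - H))))"
  proof (rule sum.mono_neutral_cong_right)
    fix S assume "S \<in> avoiding k a"
    then show "tilted_weight k H c S * (real (card (S \<inter> H)) - real (card (S - H)))
        = subspace_weight k S * (real (card (S \<inter> H)) - real (card (S - H)))"
      using balanced untilted by (cases "S \<subseteq> H") (auto simp: avoiding_def)
  qed (use a balanced in \<open>auto simp: avoiding_def\<close>)
  also have "\<dots> = (\<Sum>S\<in>avoiding k a. subspace_weight k S * real (card (S \<inter> H)))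
      - (\<Sum>S\<in>avoiding k a. subspace_weight k S * real (card (S \<inter> (Wsp k - H))))"
    by (simp add: avoiding_def subspace_Int_complement right_diff_distrib sum_subtractf)
  also have "\<dots> = real (card (H - {a})) - real (card (Wsp k - H - {a}))"
    using hyperplanesD(2)[OF H] by (simp add: sum_avoiding_card[OF aW])
  also have "\<dots> = 1"
    using a card_complement_hyperplane[OF H] \<open>card (Wsp k - H) \<noteq> 0\<close>
    by (simp add: card_Diff_singleton of_nat_diff)
  finally show ?thesis .
qed

lemma sum_avoiding_tilted_diff:
  "(\<Sum>v\<in>Wsp k - H. sum (tilted_weight k H c) (avoiding k v))
    - (\<Sum>v\<in>H. sum (tilted_weight k H c) (avoiding k v)) = 1"
proof -
  let ?w = "tilted_weight k H c"
  note fin = hyperplanesD(4)[OF H]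
  have sum_avoiding: "(\<Sum>v\<in>B. sum ?w (avoiding k v))
      = real (card B) * sum ?w (subspaces k) - (\<Sum>S\<in>subspaces k. ?w S * real (card (S \<inter> B)))"
    if "finite B" for B
    using sum_weighted_sum_Int[OF finite_subspaces that, where w = ?w and z = "\<lambda>_. 1"]
    by (simp add: codegree_subspaces_singleton sum_subtractf)
  have "(\<Sum>v\<in>Wsp k - H. sum ?w (avoiding k v)) - (\<Sum>v\<in>H. sum ?w (avoiding k v))
      = (\<Sum>S\<in>subspaces k. ?w S * (real (card (S \<inter> H)) - real (card (S - H))))"
    using fin
    by (simp add: sum_avoiding subspace_Int_complement card_complement_hyperplane[OF H]
        right_diff_distrib sum_subtractf)
  then show ?thesis using sum_tilted_card_diff by simp
qed

lemma sum_avoiding_tilted_gap: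
  assumes a: "a \<in> Wsp k - H" and h: "h \<in> H" "h \<noteq> vzero"
  shows "real (card H) * (sum (tilted_weight k H c) (avoiding k a)
      - sum (tilted_weight k H c) (avoiding k h)) = 1 - sum (tilted_weight k H c) (avoiding k h)"
proof -
  let ?w = "tilted_weight k H c"
  let ?U = "\<lambda>v. sum ?w (avoiding k v)"
  note fin = hyperplanesD(4)[OF H]
  have "(\<Sum>v\<in>Wsp k - H. ?U v) = (\<Sum>v\<in>Wsp k - H. ?U a)"
    by (intro sum.cong refl sum_avoiding_tilted_const(1) a)
  moreover have "(\<Sum>v\<in>H. ?U v) = (real (card H) - 1) * ?U h"
  proof -
    have "avoiding k vzero = {}" using subspacesD(2) by (auto simp: avoiding_def)
    then have "(\<Sum>v\<in>H. ?U v) = (\<Sum>v\<in>H - {vzero}. ?U v)"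
      by (simp add: sum.remove[OF fin hyperplanesD(3)[OF H]])
    also have "\<dots> = (\<Sum>v\<in>H - {vzero}. ?U h)"
      using h by (intro sum.cong refl sum_avoiding_tilted_const(2)) auto
    finally show ?thesis
      using card_hyperplane_pos[OF H] hyperplanesD(3)[OF H]
      by (simp add: card_Diff_singleton of_nat_diff Suc_leI)
  qed
  ultimately show ?thesis
    using sum_avoiding_tilted_diff by (simp add: card_complement_hyperplane[OF H] algebra_simps)
qed

lemma tilted_curvature_pos:
  assumes c: "c > 0" and a: "a \<in> Wsp k - H" and h: "h \<in> H" "h \<noteq> vzero"
  shows "tilted_curvature k H c a h > 0"
proof -
  let ?w = "tilted_weight k H c" and ?A = "Wsp k - H" and ?m = "real (card H)"
  let ?E = "codegree (avoiding k h) ?w {a}"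
  have "(\<Sum>v\<in>?A. codegree (avoiding k h) ?w {v}) = (\<Sum>v\<in>?A. ?E)"
    using codegree_avoiding_tilted_const a h by (intro sum.cong refl) blast
  then have E: "?m * ?E = (\<Sum>S\<in>avoiding k h. ?w S * real (card (S \<inter> ?A)))"
    using sum_weighted_sum_Int[of "avoiding k h" ?A ?w "\<lambda>_. 1"]
    by (simp add: card_complement_hyperplane[OF H])
  have "?m * tilted_curvature k H c a h = 1 - sum ?w (avoiding k h) + c * (?m * ?E)"
    using sum_avoiding_tilted_gap[OF a h] by (simp add: tilted_curvature_def algebra_simps)
  also have "\<dots> = 1 + (\<Sum>S\<in>avoiding k h. subspace_weight k S
      * ((c * real (card (S \<inter> ?A)) - 1) * exp (c * real (card (S \<inter> ?A)))))"
    unfolding E sum_distrib_left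
    by (simp add: tilted_weight_def avoiding_def subspace_Int_complement algebra_simps
        sum_subtractf)
  also have "\<dots> > 0"
    using sum_avoiding_minus_one_times_exp_gt[of h k ?A a c] a h c hyperplanesD(2)[OF H]
    by fastforce
  finally show ?thesis using card_hyperplane_pos[OF H] by (simp add: zero_less_mult_iff)
qed

end

section \<open>Second-order expansion\<close>

lemma abs_sum_weighted_le:
  fixes w f :: "'a \<Rightarrow> real"
  assumes "\<And>S. S \<in> F \<Longrightarrow> \<bar>f S\<bar> \<le> b"
  shows "\<bar>\<Sum>S\<in>F. w S * f S\<bar> \<le> (\<Sum>S\<in>F. \<bar>w S\<bar>) * b"
proof -
  have "\<bar>\<Sum>S\<in>F. w S * f S\<bar> \<le> (\<Sum>S\<in>F. \<bar>w S * f S\<bar>)" by (rule sum_abs)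
  also have "\<dots> \<le> (\<Sum>S\<in>F. \<bar>w S\<bar> * b)"
    by (intro sum_mono) (auto simp: abs_mult intro!: mult_left_mono assms)
  finally show ?thesis by (simp add: sum_distrib_right)
qed

lemma exp_second_order_remainder:
  fixes t :: real
  assumes "\<bar>t\<bar> \<le> 1"
  shows "\<bar>exp t - (1 + t + t\<^sup>2 / 2)\<bar> \<le> 2 * \<bar>t\<bar> ^ 3"
proof -
  have "\<bar>exp t - (1 + t + t\<^sup>2 / 2)\<bar> \<le> exp \<bar>t\<bar> * \<bar>t\<bar> ^ 3 / 2"
    using Taylor_exp_field[of t 2] by (simp add: eval_nat_numeral add.assoc)
  moreover have "exp \<bar>t\<bar> \<le> 4"
    using assms exp_le order_trans[of "exp \<bar>t\<bar>" "exp 1" 4] by simp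
  then have "exp \<bar>t\<bar> * \<bar>t\<bar> ^ 3 / 2 \<le> 4 * \<bar>t\<bar> ^ 3 / 2"
    by (intro divide_right_mono mult_right_mono) auto
  ultimately show ?thesis by simp
qed

lemma sum_weighted_exp_second_order:
  fixes w t :: "'a \<Rightarrow> real"
  assumes t: "\<And>S. S \<in> F \<Longrightarrow> \<bar>t S\<bar> \<le> b" and b: "b \<le> 1"
  shows "\<bar>(\<Sum>S\<in>F. w S * exp (t S)) - (sum w F + (\<Sum>S\<in>F. w S * t S) + (\<Sum>S\<in>F. w S * (t S)\<^sup>2) / 2)\<bar>
    \<le> (\<Sum>S\<in>F. \<bar>w S\<bar>) * (2 * b ^ 3)"
proof -
  have "\<bar>exp (t S) - (1 + t S + (t S)\<^sup>2 / 2)\<bar> \<le> 2 * b ^ 3" if "S \<in> F" for S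
  proof -
    have "\<bar>exp (t S) - (1 + t S + (t S)\<^sup>2 / 2)\<bar> \<le> 2 * \<bar>t S\<bar> ^ 3"
      using t[OF that] b by (intro exp_second_order_remainder) simp
    also have "\<dots> \<le> 2 * b ^ 3" using t[OF that] by (simp add: power_mono)
    finally show ?thesis .
  qed
  then have "\<bar>\<Sum>S\<in>F. w S * (exp (t S) - (1 + t S + (t S)\<^sup>2 / 2))\<bar> \<le> (\<Sum>S\<in>F. \<bar>w S\<bar>) * (2 * b ^ 3)"
    by (rule abs_sum_weighted_le)
  then show ?thesis
    by (simp add: algebra_simps sum.distrib sum_subtractf sum_divide_distrib)
qed

lemma L2_set_power2: "(L2_set z W)\<^sup>2 = (\<Sum>v\<in>W. (z v)\<^sup>2)"
  by (simp add: L2_set_def sum_nonneg)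

lemma abs_le_L2_set:
  assumes "finite W" "v \<in> W"
  shows "\<bar>z v\<bar> \<le> L2_set z W"
  using member_le_L2_set[OF assms, of "\<lambda>v. \<bar>z v\<bar>"] by (simp add: L2_set_def)

lemma abs_sum_le_card_L2_set:
  assumes "finite W" "T \<subseteq> W"
  shows "\<bar>sum z T\<bar> \<le> real (card W) * L2_set z W"
proof -
  have "\<bar>sum z T\<bar> \<le> (\<Sum>v\<in>T. \<bar>z v\<bar>)" by (rule sum_abs)
  also have "\<dots> \<le> (\<Sum>v\<in>W. \<bar>z v\<bar>)" using assms by (intro sum_mono2) auto
  also have "\<dots> \<le> (\<Sum>v\<in>W. L2_set z W)"
    by (intro sum_mono abs_le_L2_set[OF assms(1)])
  finally show ?thesis by simp
qed

lemma sum_power2_le_sum_mult_L2_set: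
  assumes "finite W" "A \<subseteq> W" and nonneg: "\<And>v. v \<in> A \<Longrightarrow> 0 \<le> z v"
  shows "(\<Sum>v\<in>A. (z v)\<^sup>2) \<le> sum z A * L2_set z W"
proof -
  have "(z v)\<^sup>2 \<le> z v * L2_set z W" if "v \<in> A" for v
    using abs_le_L2_set[OF assms(1), of v z] nonneg[OF that] that assms(2)
    unfolding power2_eq_square by (intro mult_left_mono) auto
  then show ?thesis unfolding sum_distrib_right by (rule sum_mono)
qed

text \<open>Displacements \<open>z\<close> from the uniform distribution on the complement of \<open>H\<close>: the last condition
  is what remains of the radius constraint. It makes the mass moved onto \<open>H\<close> quadratic in the
  displacement, so that the first-order term competes with the second-order one.\<close>

definition exclusion_steps :: "nat \<Rightarrow> (nat \<Rightarrow> bool) set \<Rightarrow> ((nat \<Rightarrow> bool) \<Rightarrow> real) set" where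
  "exclusion_steps k H = {z. z vzero = 0 \<and> (\<forall>v\<in>H. 0 \<le> z v) \<and> sum z (Wsp k) = 0
    \<and> 2 * sum z H = real (card H) * (L2_set z (Wsp k))\<^sup>2}"

lemma exclusion_stepsD:
  assumes "z \<in> exclusion_steps k H"
  shows "z vzero = 0" "\<And>v. v \<in> H \<Longrightarrow> 0 \<le> z v" "sum z (Wsp k) = 0"
    "2 * sum z H = real (card H) * (L2_set z (Wsp k))\<^sup>2" "0 \<le> sum z H"
  using assms by (auto simp: exclusion_steps_def intro!: sum_nonneg)

context
  fixes k :: nat and H :: "(nat \<Rightarrow> bool) set" and c :: real and a h :: "nat \<Rightarrow> bool"
    and w :: "(nat \<Rightarrow> bool) set \<Rightarrow> real"
  defines "w \<equiv> tilted_weight k H c"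
  assumes H: "H \<in> hyperplanes k" and a: "a \<in> Wsp k - H" and h: "h \<in> H" "h \<noteq> vzero"
begin

lemma sum_tilted_complement_power2:
  "(\<Sum>S\<in>subspaces k. w S * (sum z (S - H))\<^sup>2)
    = codegree (avoiding k h) w {a} * (\<Sum>v\<in>Wsp k - H. (z v)\<^sup>2)
      + (codegree (subspaces k) w {a} - codegree (avoiding k h) w {a}) * (sum z (Wsp k - H))\<^sup>2"
  (is "_ = ?E * _ + (?D - ?E) * _")
proof -
  have "codegree (subspaces k) w {i, j} = ?D - of_bool (i \<noteq> j) * ?E"
    if i: "i \<in> Wsp k - H" and j: "j \<in> Wsp k - H" for i j
  proof -
    have single: "codegree (subspaces k) w {i} = ?D"
      using sum_avoiding_tilted_const(1)[OF H i a] by (simp add: codegree_subspaces_singleton w_def)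
    show ?thesis
    proof (cases "i = j")
      case False
      then have "vadd i j \<in> H" "vadd i j \<noteq> vzero" using hyperplane_vadd_iff[OF H] i j by auto
      then have "codegree (avoiding k (vadd i j)) w {i} = ?E"
        unfolding w_def by (rule codegree_avoiding_tilted_const[OF H i a _ _ h])
      then show ?thesis using False single codegree_subspaces_pair[of k w i j] by simp
    qed (use single in simp)
  qed
  then show ?thesis
    using sum_weighted_sum_Int_power2[of "subspaces k" "Wsp k - H" w z]
      quadratic_form_const[of "Wsp k - H" z ?D ?E]
    by (simp add: subspace_Int_complement)
qed

context
  fixes z :: "(nat \<Rightarrow> bool) \<Rightarrow> real"
  assumes z: "z \<in> exclusion_steps k H"
begin

lemma sum_exclusion_step_complement: "sum z (Wsp k - H) = - sum z H"
  using exclusion_stepsD(3)[OF z] sum_Wsp_hyperplane[OF H, of z] by simp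

lemma sum_tilted_exclusion_step:
  "(\<Sum>S\<in>subspaces k. w S * sum z S) = (sum w (avoiding k a) - sum w (avoiding k h)) * sum z H"
proof -
  have "(\<Sum>S\<in>subspaces k. w S * sum z S) = (\<Sum>S\<in>subspaces k. w S * sum z (S \<inter> Wsp k))"
    using subspacesD(1) by (intro sum.cong refl) (simp add: inf.absorb1)
  also have "\<dots> = (\<Sum>v\<in>Wsp k. z v * codegree (subspaces k) w {v})"
    by (intro sum_weighted_sum_Int) auto
  also have "\<dots> = sum z (Wsp k) * sum w (subspaces k) - (\<Sum>v\<in>Wsp k. z v * sum w (avoiding k v))"
    by (simp add: codegree_subspaces_singleton right_diff_distrib sum_subtractf sum_distrib_right)
  also have "(\<Sum>v\<in>Wsp k. z v * sum w (avoiding k v))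
      = (\<Sum>v\<in>H. z v * sum w (avoiding k h)) + (\<Sum>v\<in>Wsp k - H. z v * sum w (avoiding k a))"
  proof -
    have "z v * sum w (avoiding k v) = z v * sum w (avoiding k h)" if "v \<in> H" for v
      using sum_avoiding_tilted_const(2)[OF H that _ h] exclusion_stepsD(1)[OF z]
      by (cases "v = vzero") (simp_all add: w_def)
    moreover have "sum w (avoiding k v) = sum w (avoiding k a)" if "v \<in> Wsp k - H" for v
      using sum_avoiding_tilted_const(1)[OF H that a] by (simp add: w_def)
    ultimately show ?thesis
      unfolding sum_Wsp_hyperplane[OF H]
      by (intro arg_cong2[where f = "(+)"] sum.cong refl) simp_all
  qed
  finally show ?thesis
    by (simp add: exclusion_stepsD(3)[OF z] sum_exclusion_step_complement algebra_simps
        flip: sum_distrib_right)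
qed

lemma sum_tilted_exclusion_step_power2_diff:
  "\<bar>\<Sum>S\<in>subspaces k. w S * ((sum z S)\<^sup>2 - (sum z (S - H))\<^sup>2)\<bar>
    \<le> (\<Sum>S\<in>subspaces k. \<bar>w S\<bar>) * (2 * real (card (Wsp k)) * sum z H * L2_set z (Wsp k))"
proof (rule abs_sum_weighted_le)
  fix S assume S: "S \<in> subspaces k"
  let ?NR = "real (card (Wsp k)) * L2_set z (Wsp k)"
  note SW = subspacesD(1)[OF S]
  have split: "sum z S = sum z (S \<inter> H) + sum z (S - H)"
    using sum.Int_Diff[OF finite_subspace[OF S]] .
  have "\<bar>sum z S\<bar> \<le> ?NR" "\<bar>sum z (S - H)\<bar> \<le> ?NR"
    using SW by (auto intro!: abs_sum_le_card_L2_set)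
  then have "\<bar>sum z S + sum z (S - H)\<bar> \<le> 2 * ?NR" by linarith
  moreover have "0 \<le> sum z (S \<inter> H)" "sum z (S \<inter> H) \<le> sum z H"
    using exclusion_stepsD(2)[OF z] hyperplanesD(4)[OF H]
    by (auto intro!: sum_nonneg sum_mono2)
  ultimately have "\<bar>sum z (S \<inter> H) * (sum z S + sum z (S - H))\<bar> \<le> sum z H * (2 * ?NR)"
    unfolding abs_mult by (intro mult_mono) auto
  moreover have "(sum z S)\<^sup>2 - (sum z (S - H))\<^sup>2 = sum z (S \<inter> H) * (sum z S + sum z (S - H))"
    unfolding split by (simp add: power2_eq_square algebra_simps)
  ultimately show "\<bar>(sum z S)\<^sup>2 - (sum z (S - H))\<^sup>2\<bar>
      \<le> 2 * real (card (Wsp k)) * sum z H * L2_set z (Wsp k)"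
    by (simp add: mult_ac)
qed

lemma sum_tilted_exclusion_step_power2:
  "\<bar>(\<Sum>S\<in>subspaces k. w S * (sum z S)\<^sup>2) - codegree (avoiding k h) w {a} * (L2_set z (Wsp k))\<^sup>2\<bar>
    \<le> ((\<Sum>S\<in>subspaces k. \<bar>w S\<bar>) * (2 * real (card (Wsp k))) + \<bar>codegree (avoiding k h) w {a}\<bar>
        + \<bar>codegree (subspaces k) w {a} - codegree (avoiding k h) w {a}\<bar> * real (card (Wsp k)))
      * (sum z H * L2_set z (Wsp k))"
  (is "\<bar>?Q - ?E * ?R\<^sup>2\<bar> \<le> (?B * (2 * ?N) + \<bar>?E\<bar> + \<bar>?D - ?E\<bar> * ?N) * (?Y * ?R)")
proof -
  let ?X = "\<Sum>S\<in>subspaces k. w S * ((sum z S)\<^sup>2 - (sum z (S - H))\<^sup>2)"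
  let ?h = "\<Sum>v\<in>H. (z v)\<^sup>2"
  have HW: "H \<subseteq> Wsp k" using hyperplanesD(2)[OF H] .
  have triangle: "\<bar>x - e * s + d * t\<bar> \<le> \<bar>x\<bar> + \<bar>e\<bar> * s + \<bar>d\<bar> * t" if "0 \<le> s" "0 \<le> t"
    for x e s d t :: real
    using that abs_triangle_ineq[of "x - e * s" "d * t"] abs_triangle_ineq4[of x "e * s"]
    by (simp add: abs_mult)
  have "?R\<^sup>2 = ?h + (\<Sum>v\<in>Wsp k - H. (z v)\<^sup>2)"
    unfolding L2_set_power2 by (rule sum_Wsp_hyperplane[OF H])
  moreover have "?Q = ?X + (\<Sum>S\<in>subspaces k. w S * (sum z (S - H))\<^sup>2)"
    by (simp add: right_diff_distrib sum_subtractf)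
  ultimately have expansion: "?Q - ?E * ?R\<^sup>2 = ?X - ?E * ?h + (?D - ?E) * ?Y\<^sup>2"
    unfolding sum_tilted_complement_power2 sum_exclusion_step_complement
    by (simp add: algebra_simps)
  have "\<bar>?Q - ?E * ?R\<^sup>2\<bar> \<le> \<bar>?X\<bar> + \<bar>?E\<bar> * ?h + \<bar>?D - ?E\<bar> * ?Y\<^sup>2"
    unfolding expansion by (rule triangle) (simp_all add: sum_nonneg)
  also have "\<dots> \<le> ?B * (2 * ?N * ?Y * ?R) + \<bar>?E\<bar> * (?Y * ?R) + \<bar>?D - ?E\<bar> * (?N * ?R * ?Y)"
  proof -
    have "?h \<le> ?Y * ?R"
      using sum_power2_le_sum_mult_L2_set[OF finite_Wsp HW, of z] exclusion_stepsD(2)[OF z] by blast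
    moreover have "?Y\<^sup>2 \<le> ?N * ?R * ?Y"
      using abs_sum_le_card_L2_set[OF finite_Wsp HW, of z] exclusion_stepsD(5)[OF z]
      by (simp add: power2_eq_square mult_right_mono)
    ultimately show ?thesis
      by (intro add_mono mult_left_mono sum_tilted_exclusion_step_power2_diff abs_ge_zero)
  qed
  finally show ?thesis by (simp add: algebra_simps)
qed

lemma sum_tilted_exp_exclusion_step:
  assumes lam: "0 \<le> lam" and small: "lam * (real (card (Wsp k)) * L2_set z (Wsp k)) \<le> 1"
  shows "\<bar>(\<Sum>S\<in>subspaces k. w S * exp (lam * sum z S))
      - (sum w (subspaces k) + lam * (\<Sum>S\<in>subspaces k. w S * sum z S)
        + lam\<^sup>2 / 2 * (\<Sum>S\<in>subspaces k. w S * (sum z S)\<^sup>2))\<bar>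
    \<le> (\<Sum>S\<in>subspaces k. \<bar>w S\<bar>) * (2 * (lam * (real (card (Wsp k)) * L2_set z (Wsp k))) ^ 3)"
proof -
  have bound: "\<bar>lam * sum z S\<bar> \<le> lam * (real (card (Wsp k)) * L2_set z (Wsp k))"
    if "S \<in> subspaces k" for S
    using abs_sum_le_card_L2_set[OF finite_Wsp subspacesD(1)[OF that], of z] lam
    by (simp add: abs_mult mult_left_mono)
  have "(\<Sum>S\<in>subspaces k. w S * (lam * sum z S)) = lam * (\<Sum>S\<in>subspaces k. w S * sum z S)"
    by (subst sum_distrib_left) (simp only: mult.left_commute)
  moreover have "(\<Sum>S\<in>subspaces k. w S * (lam * sum z S)\<^sup>2)
      = lam\<^sup>2 * (\<Sum>S\<in>subspaces k. w S * (sum z S)\<^sup>2)"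
    by (subst sum_distrib_left) (simp only: power_mult_distrib mult.left_commute)
  ultimately show ?thesis
    using sum_weighted_exp_second_order[where F = "subspaces k" and w = w
        and t = "\<lambda>S. lam * sum z S", OF bound small]
    by simp
qed

end

text \<open>Since \<open>\<lambda>\<^sup>2 |z|\<^sup>2 / 2 = \<lambda> c \<Sum>\<^sub>H z\<close> for \<open>c = \<lambda> / |H|\<close>, the first- and second-order terms combine
  into the curvature.\<close>

lemma sum_tilted_exp_exclusion_step_ge:
  assumes lam: "lam > 0" and c: "c = lam / real (card H)"
  obtains C where "\<And>z. z \<in> exclusion_steps k H \<Longrightarrow>
    lam * (real (card (Wsp k)) * L2_set z (Wsp k)) \<le> 1 \<Longrightarrow>
    sum w (subspaces k) + sum z H * (lam * tilted_curvature k H c a h - C * L2_set z (Wsp k))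
      \<le> (\<Sum>S\<in>subspaces k. w S * exp (lam * sum z S))"
proof -
  define N where "N = real (card (Wsp k))"
  define B where "B = (\<Sum>S\<in>subspaces k. \<bar>w S\<bar>)"
  define E where "E = codegree (avoiding k h) w {a}"
  define D where "D = codegree (subspaces k) w {a}"
  define G where "G = sum w (avoiding k a) - sum w (avoiding k h)"
  define C2 where "C2 = B * (2 * N) + \<bar>E\<bar> + \<bar>D - E\<bar> * N"
  define C where "C = lam\<^sup>2 / 2 * C2 + 4 * B * (lam * N) ^ 3 / real (card H)"
  have "sum w (subspaces k) + sum z H * (lam * (G + c * E) - C * L2_set z (Wsp k))
      \<le> (\<Sum>S\<in>subspaces k. w S * exp (lam * sum z S))"
    if z: "z \<in> exclusion_steps k H" and small: "lam * (N * L2_set z (Wsp k)) \<le> 1" for z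
  proof -
    define R where "R = L2_set z (Wsp k)"
    define Y where "Y = sum z H"
    define Q where "Q = (\<Sum>S\<in>subspaces k. w S * (sum z S)\<^sup>2)"
    have R2: "R\<^sup>2 = 2 * Y / real (card H)"
      using exclusion_stepsD(4)[OF z] card_hyperplane_pos[OF H]
      by (simp add: R_def Y_def field_simps)
    have cube: "(lam * (N * R)) ^ 3 = (lam * N) ^ 3 * (R\<^sup>2 * R)"
      by (simp add: power_mult_distrib power2_eq_square power3_eq_cube)
    have "\<bar>Q - E * R\<^sup>2\<bar> \<le> C2 * (Y * R)"
      using sum_tilted_exclusion_step_power2[OF z]
      by (simp add: Q_def E_def D_def C2_def B_def N_def R_def Y_def)
    then have "lam\<^sup>2 / 2 * (E * R\<^sup>2 - C2 * (Y * R)) \<le> lam\<^sup>2 / 2 * Q"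
      by (intro mult_left_mono) auto
    moreover have "sum w (subspaces k) + lam * (G * Y) + lam\<^sup>2 / 2 * Q
        - B * (2 * (lam * (N * R)) ^ 3)
        \<le> (\<Sum>S\<in>subspaces k. w S * exp (lam * sum z S))"
      using sum_tilted_exp_exclusion_step[OF z less_imp_le[OF lam]] small
      by (simp add: sum_tilted_exclusion_step[OF z] abs_le_iff G_def Y_def Q_def B_def N_def R_def)
    moreover have "lam * (G * Y) + lam\<^sup>2 / 2 * (E * R\<^sup>2 - C2 * (Y * R))
        - B * (2 * (lam * (N * R)) ^ 3)
        = Y * (lam * (G + c * E) - C * R)"
      unfolding cube C_def c R2 by (simp add: field_simps power2_eq_square)
    ultimately show ?thesis unfolding R_def[symmetric] Y_def[symmetric] by linarith
  qed
  then show thesis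
    using that[of C] unfolding G_def E_def N_def w_def tilted_curvature_def by blast
qed

lemma sum_tilted_exp_exclusion_step_local_min:
  assumes lam: "lam > 0" and c: "c = lam / real (card H)"
  obtains r where "r > 0" "\<And>z. z \<in> exclusion_steps k H \<Longrightarrow> L2_set z (Wsp k) < r \<Longrightarrow>
    sum w (subspaces k) \<le> (\<Sum>S\<in>subspaces k. w S * exp (lam * sum z S))"
proof -
  define N where "N = real (card (Wsp k))"
  define g where "g = tilted_curvature k H c a h"
  have "c > 0" unfolding c using lam card_hyperplane_pos[OF H] by (rule divide_pos_pos)
  then have g: "g > 0" unfolding g_def by (rule tilted_curvature_pos[OF H _ a h])
  obtain C where C: "\<And>z. z \<in> exclusion_steps k H \<Longrightarrow> lam * (N * L2_set z (Wsp k)) \<le> 1 \<Longrightarrow>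
      sum w (subspaces k) + sum z H * (lam * g - C * L2_set z (Wsp k))
        \<le> (\<Sum>S\<in>subspaces k. w S * exp (lam * sum z S))"
    using sum_tilted_exp_exclusion_step_ge[OF assms] unfolding g_def N_def by blast
  have N: "N > 0" by (simp add: N_def card_Wsp)
  define r where "r = min (1 / (lam * N)) (lam * g / (\<bar>C\<bar> + 1))"
  have "r > 0" unfolding r_def using lam N g by simp
  moreover have "sum w (subspaces k) \<le> (\<Sum>S\<in>subspaces k. w S * exp (lam * sum z S))"
    if z: "z \<in> exclusion_steps k H" and near: "L2_set z (Wsp k) < r" for z
  proof -
    define R where "R = L2_set z (Wsp k)"
    have R: "0 \<le> R" "R < 1 / (lam * N)" "R < lam * g / (\<bar>C\<bar> + 1)"
      using near by (auto simp: R_def r_def)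
    have "C * R \<le> (\<bar>C\<bar> + 1) * R" using R(1) by (intro mult_right_mono) auto
    also have "\<dots> \<le> lam * g" using R(3) by (simp add: field_simps)
    finally have "0 \<le> sum z H * (lam * g - C * R)"
      using exclusion_stepsD(5)[OF z] by (intro mult_nonneg_nonneg) auto
    moreover have "lam * (N * R) \<le> 1" using R(2) lam N by (simp add: field_simps)
    ultimately show ?thesis using C[OF z] unfolding R_def by linarith
  qed
  ultimately show thesis using that by blast
qed

end

section \<open>Local minimality for an arbitrary hyperplane\<close>

definition exp_sum :: "nat \<Rightarrow> real \<Rightarrow> ((nat \<Rightarrow> bool) \<Rightarrow> real) \<Rightarrow> real" where
  "exp_sum k lam x = (\<Sum>S\<in>subspaces k. subspace_weight k S * exp (lam * sum x S))"

definition uniform_off :: "nat \<Rightarrow> (nat \<Rightarrow> bool) set \<Rightarrow> (nat \<Rightarrow> bool) \<Rightarrow> real" where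
  "uniform_off k H v = of_bool (v \<in> Wsp k - H) / real (card H)"

definition simplex_sphere :: "nat \<Rightarrow> real \<Rightarrow> ((nat \<Rightarrow> bool) \<Rightarrow> real) set" where
  "simplex_sphere k s = {x. x vzero = 0 \<and> (\<forall>v\<in>Wsp k. 0 \<le> x v) \<and> sum x (Wsp k) = 1
    \<and> (\<Sum>v\<in>Wsp k. (x v)\<^sup>2) = s}"

lemma sum_uniform_off:
  "finite S \<Longrightarrow> (\<Sum>v\<in>S. uniform_off k H v * f v) = sum f (S \<inter> (Wsp k - H)) / real (card H)"
  unfolding uniform_off_def sum_divide_distrib
  by (rule sum.mono_neutral_cong_right) auto

lemma sum_uniform_off_subspace:
  assumes "S \<in> subspaces k"
  shows "sum (uniform_off k H) S = real (card (S - H)) / real (card H)"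
  using sum_uniform_off[OF finite_subspace[OF assms], of k H "\<lambda>_. 1"]
  by (simp add: subspace_Int_complement[OF assms])

context
  fixes k :: nat and H :: "(nat \<Rightarrow> bool) set"
  assumes H: "H \<in> hyperplanes k"
begin

lemma uniform_off_in_simplex_sphere: "uniform_off k H \<in> simplex_sphere k (1 / real (card H))"
proof -
  have "sum (uniform_off k H) (Wsp k) = 1"
    using sum_uniform_off_subspace[OF Wsp_in_subspaces] card_hyperplane_pos[OF H]
    by (simp add: card_complement_hyperplane[OF H])
  moreover have "(\<Sum>v\<in>Wsp k. (uniform_off k H v)\<^sup>2)
      = sum (uniform_off k H) (Wsp k - H) / real (card H)"
    unfolding power2_eq_square using sum_uniform_off[OF finite_Wsp] by (simp add: Int_absorb1)
  moreover have "sum (uniform_off k H) (Wsp k - H) = sum (uniform_off k H) (Wsp k)"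
    by (rule sum.mono_neutral_left) (auto simp: uniform_off_def)
  ultimately show ?thesis
    using hyperplanesD(3)[OF H] by (simp add: simplex_sphere_def uniform_off_def)
qed

lemma simplex_sphere_minus_uniform_off:
  assumes x: "x \<in> simplex_sphere k (1 / real (card H))"
  shows "(\<lambda>v. x v - uniform_off k H v) \<in> exclusion_steps k H"
proof -
  let ?p = "uniform_off k H" and ?m = "real (card H)"
  note xD = x[unfolded simplex_sphere_def mem_Collect_eq]
  note pD = uniform_off_in_simplex_sphere[unfolded simplex_sphere_def mem_Collect_eq]
  have HW: "H \<subseteq> Wsp k" using hyperplanesD(2)[OF H] .
  have p0: "?p v = 0" if "v \<in> H" for v using that by (simp add: uniform_off_def)
  have "(\<Sum>v\<in>Wsp k. (x v - ?p v)\<^sup>2)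
      = (\<Sum>v\<in>Wsp k. (x v)\<^sup>2) + (\<Sum>v\<in>Wsp k. (?p v)\<^sup>2) - 2 * (\<Sum>v\<in>Wsp k. ?p v * x v)"
    by (simp add: power2_diff sum.distrib sum_subtractf sum_distrib_left mult_ac)
  also have "\<dots> = 2 / ?m - 2 * (sum x (Wsp k - H) / ?m)"
    using xD pD sum_uniform_off[OF finite_Wsp, of k H x] by (simp add: Int_absorb1)
  also have "sum x (Wsp k - H) = 1 - sum x H"
    using xD HW finite_subset[OF HW] by (simp add: sum_diff)
  also have "2 / ?m - 2 * ((1 - sum x H) / ?m) = 2 * sum x H / ?m"
    by (simp add: diff_divide_distrib)
  finally have "?m * (L2_set (\<lambda>v. x v - ?p v) (Wsp k))\<^sup>2 = 2 * sum x H"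
    using card_hyperplane_pos[OF H] by (simp add: L2_set_power2)
  moreover have "(\<Sum>v\<in>H. x v - ?p v) = sum x H" using p0 by simp
  moreover have "(\<Sum>v\<in>Wsp k. x v - ?p v) = 0" using xD pD by (simp add: sum_subtractf)
  ultimately show ?thesis using xD pD p0 HW by (auto simp: exclusion_steps_def)
qed

lemma exp_sum_uniform_off_plus:
  "exp_sum k lam (\<lambda>v. uniform_off k H v + z v)
    = (\<Sum>S\<in>subspaces k. tilted_weight k H (lam / real (card H)) S * exp (lam * sum z S))"
  unfolding exp_sum_def tilted_weight_def
  by (intro sum.cong refl)
    (simp add: sum.distrib sum_uniform_off_subspace distrib_left exp_add)

theorem exp_sum_uniform_off_local_min:
  assumes lam: "lam > 0" and nontrivial: "H \<noteq> {vzero}"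
  obtains r where "r > 0" "\<And>x. x \<in> simplex_sphere k (1 / real (card H)) \<Longrightarrow>
    L2_set (\<lambda>v. x v - uniform_off k H v) (Wsp k) < r \<Longrightarrow>
    exp_sum k lam (uniform_off k H) \<le> exp_sum k lam x"
proof -
  let ?w = "tilted_weight k H (lam / real (card H))"
  obtain a where a: "a \<in> Wsp k - H" using complement_hyperplane_nonempty[OF H] .
  obtain h where h: "h \<in> H" "h \<noteq> vzero" using nontrivial hyperplanesD(3)[OF H] by auto
  obtain r where r: "r > 0" and local_min: "\<And>z. z \<in> exclusion_steps k H \<Longrightarrow> L2_set z (Wsp k) < r \<Longrightarrow>
      sum ?w (subspaces k) \<le> (\<Sum>S\<in>subspaces k. ?w S * exp (lam * sum z S))"
    using sum_tilted_exp_exclusion_step_local_min[OF H a h lam refl] by blast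
  have "exp_sum k lam (uniform_off k H) \<le> exp_sum k lam x"
    if x: "x \<in> simplex_sphere k (1 / real (card H))"
      and near: "L2_set (\<lambda>v. x v - uniform_off k H v) (Wsp k) < r" for x
    using local_min[OF simplex_sphere_minus_uniform_off[OF x] near]
      exp_sum_uniform_off_plus[of lam "\<lambda>v. x v - uniform_off k H v"]
      exp_sum_uniform_off_plus[of lam "\<lambda>_. 0"]
    by simp
  then show thesis using that r by blast
qed

end

section \<open>Code vectors as functions on the vector space\<close>

definition coord :: "nat \<Rightarrow> (nat \<Rightarrow> real) \<Rightarrow> (nat \<Rightarrow> bool) \<Rightarrow> real" where
  "coord k q v = (if v \<in> Wsp k then q (inv_into {..<2^k} (nu k) v) else 0)"

lemma nu_in_Wsp: "nu k i \<in> Wsp k"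
  by (simp add: nu_def Wsp_def)

lemma coord_nu: "i < 2^k \<Longrightarrow> coord k q (nu k i) = q i"
  using bij_betw_nu[of k] by (simp add: coord_def nu_in_Wsp bij_betw_def)

lemma Wsp_cases:
  assumes "v \<in> Wsp k"
  obtains i where "i < 2^k" "v = nu k i"
  using assms bij_betw_nu[of k] by (auto simp: bij_betw_def)

lemma sum_Wsp_coord: "(\<Sum>v\<in>Wsp k. f (coord k q v)) = (\<Sum>i<2^k. f (q i))"
  using sum.reindex_bij_betw[OF bij_betw_nu, of "\<lambda>v. f (coord k q v)" k] by (simp add: coord_nu)

lemma zeta_eq_sum_coord:
  assumes "S \<subseteq> Wsp k"
  shows "zeta k S q = sum (coord k q) S"
proof -
  have "bij_betw (nu k) {i. i < 2^k \<and> nu k i \<in> S} S"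
    by (rule bij_betw_subset[OF bij_betw_nu])
      (use bij_betw_nu[of k] assms in \<open>auto simp: bij_betw_def\<close>)
  from sum.reindex_bij_betw[OF this, of "coord k q"] show ?thesis
    by (simp add: zeta_def coord_nu)
qed

lemma vdist_eq_L2_set_coord:
  "vdist k q q' = L2_set (\<lambda>v. coord k q' v - coord k q v) (Wsp k)"
proof -
  have "(\<Sum>i<2^k. (q i - q' i)\<^sup>2) = (\<Sum>v\<in>Wsp k. (coord k q' v - coord k q v)\<^sup>2)"
    using sum.reindex_bij_betw[OF bij_betw_nu, of "\<lambda>v. (coord k q' v - coord k q v)\<^sup>2" k]
    by (simp add: coord_nu power2_commute)
  then show ?thesis by (simp add: vdist_def L2_set_def)
qed

lemma sum_power2_diff_inverse_card:
  fixes q :: "'a \<Rightarrow> real"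
  assumes "finite A" "A \<noteq> {}" "sum q A = 1"
  shows "(\<Sum>i\<in>A. (q i - 1 / real (card A))\<^sup>2) = (\<Sum>i\<in>A. (q i)\<^sup>2) - 1 / real (card A)"
proof -
  define u where "u = 1 / real (card A)"
  have "(\<Sum>i\<in>A. (q i - u)\<^sup>2) = (\<Sum>i\<in>A. (q i)\<^sup>2) - 2 * u * sum q A + real (card A) * u\<^sup>2"
    by (simp add: power2_diff sum.distrib sum_subtractf flip: sum_distrib_left sum_distrib_right)
  moreover have "real (card A) * u\<^sup>2 = u" using assms(1,2) by (simp add: u_def power2_eq_square)
  ultimately show ?thesis using assms(3) by (simp flip: u_def)
qed

lemma Crho_iff_coord:
  assumes k: "k \<ge> 1"
  shows "q \<in> Crho k \<longleftrightarrow> coord k q \<in> simplex_sphere k (1 / 2^(k-1))"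
proof -
  define m where "m = (2::real)^(k-1)"
  have m: "m \<ge> 1" by (simp add: m_def)
  have N: "(2::real)^k = 2 * m" using k by (simp add: m_def flip: power_Suc)
  have card: "real (card {1..<2^k::nat}) = 2 * m - 1" using N by (simp add: of_nat_diff)
  have nonempty: "{1..<2^k::nat} \<noteq> {}" using one_less_power[of "2::nat" k] k by simp
  have drop_0: "(\<Sum>i<2^k. f i) = f 0 + (\<Sum>i=1..<2^k. f i)" for f :: "nat \<Rightarrow> real"
    unfolding lessThan_atLeast0 by (subst sum.atLeast_Suc_lessThan) auto
  have "(\<Sum>i=1..<2^k. (q i - 1 / (2^k - 1))\<^sup>2) = (\<Sum>i<2^k. (q i)\<^sup>2) - 1 / (2 * m - 1)"
    if "q 0 = 0" "(\<Sum>i<2^k. q i) = 1"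
    using that nonempty m drop_0[of q] drop_0[of "\<lambda>i. (q i)\<^sup>2"]
      sum_power2_diff_inverse_card[of "{1..<2^k}" q]
    unfolding card by (auto simp: N)
  moreover have "(2^(k-1) - 1) / ((2^k - 2^(k-1)) * (2^k - 1)) = 1 / m - 1 / (2 * m - 1)"
    using m unfolding N m_def[symmetric] by (simp add: field_simps)
  ultimately have "q \<in> Crho k \<longleftrightarrow> q 0 = 0 \<and> (\<forall>i<2^k. 0 \<le> q i) \<and> (\<Sum>i<2^k. q i) = 1
      \<and> (\<Sum>i<2^k. (q i)\<^sup>2) = 1 / m"
    unfolding Crho_def mem_Collect_eq real_sqrt_eq_iff by auto
  moreover have "coord k q vzero = q 0"
    using coord_nu[of 0 k q] by (simp add: nu_def)
  moreover have "(\<forall>v\<in>Wsp k. 0 \<le> coord k q v) \<longleftrightarrow> (\<forall>i<2^k. 0 \<le> q i)"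
    by (metis Wsp_cases coord_nu nu_in_Wsp)
  ultimately show ?thesis
    using sum_Wsp_coord[of "\<lambda>t. t" k q] sum_Wsp_coord[of "\<lambda>t. t\<^sup>2" k q]
    by (simp add: simplex_sphere_def m_def)
qed

lemma loss_eq_exp_sum:
  assumes eps: "eps > 0" and q: "q \<in> Crho k"
  shows "loss k n eps q = real n * (1 - eps) - real k - 1
    + exp (real n * ln eps) * exp_sum k (- (real n * ln eps)) (coord k q)"
proof -
  let ?g = "\<lambda>S. eps powr (real n * (1 - zeta k S q))"
  have "{i. i < 2^k \<and> nu k i \<in> Wsp k} = {..<2^k}" using nu_in_Wsp by auto
  then have "zeta k (Wsp k) q = 1" using q by (simp add: zeta_def Crho_def)
  then have "subspace_weight k (Wsp k) * ?g (Wsp k) = 1"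
    using eps by (simp add: subspace_weight_def codim_Wsp Kc_def)
  then have "(\<Sum>S\<in>subspaces k. subspace_weight k S * ?g S)
      = 1 + (\<Sum>S\<in>subspaces k - {Wsp k}. subspace_weight k S * ?g S)"
    by (simp add: sum.remove[OF finite_subspaces Wsp_in_subspaces])
  moreover have "(\<Sum>S\<in>subspaces k. subspace_weight k S * ?g S)
      = exp (real n * ln eps) * exp_sum k (- (real n * ln eps)) (coord k q)"
    unfolding exp_sum_def sum_distrib_left[of "exp (real n * ln eps)"]
  proof (intro sum.cong refl)
    fix S assume "S \<in> subspaces k"
    then have "zeta k S q = sum (coord k q) S" by (intro zeta_eq_sum_coord subspacesD(1))
    then show "subspace_weight k S * ?g S = exp (real n * ln eps)
        * (subspace_weight k S * exp (- (real n * ln eps) * sum (coord k q) S))"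
      using eps by (simp add: powr_def algebra_simps flip: exp_add)
  qed
  ultimately show ?thesis unfolding loss_def sum_Xi by simp
qed

section \<open>The first subspace exclusion code\<close>

definition last_coord_hyperplane :: "nat \<Rightarrow> (nat \<Rightarrow> bool) set" where
  "last_coord_hyperplane k = {v \<in> Wsp k. \<not> v (k - 1)}"

lemma last_coord_hyperplane_in_hyperplanes:
  assumes "k \<ge> 1"
  shows "last_coord_hyperplane k \<in> hyperplanes k"
proof -
  have "last_coord_hyperplane k \<in> subspaces k"
    using Wsp_in_subspaces[of k] by (auto simp: last_coord_hyperplane_def subspaces_def vadd_def)
  moreover have "(\<lambda>j. j = k - 1) \<in> Wsp k - last_coord_hyperplane k"
    using assms by (auto simp: last_coord_hyperplane_def Wsp_def)
  moreover have "vadd u v \<in> last_coord_hyperplane k"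
    if "u \<in> Wsp k - last_coord_hyperplane k" "v \<in> Wsp k - last_coord_hyperplane k" for u v
    using that vadd_in_Wsp[of u k v] by (auto simp: last_coord_hyperplane_def vadd_def)
  ultimately show ?thesis by (auto simp: hyperplanes_def)
qed

lemma card_last_coord_hyperplane:
  assumes "k \<ge> 1"
  shows "card (last_coord_hyperplane k) = 2^(k-1)"
proof -
  have "2 * card (last_coord_hyperplane k) = 2 * 2^(k-1)"
    using card_hyperplane[OF last_coord_hyperplane_in_hyperplanes[OF assms]] assms
    by (simp flip: power_Suc)
  then show ?thesis by simp
qed

lemma last_coord_hyperplane_nontrivial:
  assumes "k \<ge> 2"
  shows "last_coord_hyperplane k \<noteq> {vzero}"
proof -
  have "(\<lambda>j. j = 0) \<in> last_coord_hyperplane k"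
    using assms by (auto simp: last_coord_hyperplane_def Wsp_def)
  moreover have "(\<lambda>j::nat. j = 0) \<noteq> vzero" by (auto simp: fun_eq_iff)
  ultimately show ?thesis by auto
qed

lemma coord_qcheck:
  assumes k: "k \<ge> 1"
  shows "coord k (qcheck k) = uniform_off k (last_coord_hyperplane k)"
proof
  fix v
  show "coord k (qcheck k) v = uniform_off k (last_coord_hyperplane k) v"
  proof (cases "v \<in> Wsp k")
    case True
    then obtain i where i: "i < 2^k" "v = nu k i" by (rule Wsp_cases)
    have "bit i (k - 1) \<longleftrightarrow> 2^(k-1) \<le> i"
    proof (cases "2^(k-1) \<le> i")
      case True
      have "(2::nat)^k = 2 * 2^(k-1)" using k by (simp flip: power_Suc)
      then have "i div 2^(k-1) = 1" using True i(1) by (intro div_nat_eqI) auto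
      then show ?thesis using True by (simp add: bit_iff_odd)
    qed (simp add: bit_iff_odd)
    then have "v \<in> Wsp k - last_coord_hyperplane k \<longleftrightarrow> 2^(k-1) \<le> i"
      using True k i(2) by (auto simp: last_coord_hyperplane_def nu_def)
    moreover have "2 powr (1 - real k) = 1 / 2^(k-1)"
      using k by (simp add: powr_diff powr_realpow power_diff)
    ultimately show ?thesis
      using i coord_nu[OF i(1)] card_last_coord_hyperplane[OF k]
      by (simp add: uniform_off_def qcheck_def)
  qed (simp add: coord_def uniform_off_def)
qed

theorem theorem4:
  fixes k n :: nat and eps :: real
  assumes "k \<ge> 2" and "n \<ge> 1" and "0 < eps" and "eps < 1"
  shows "qcheck k \<in> Crho k \<and> local_min_on k (loss k n eps) (Crho k) (qcheck k)"
proof -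
  let ?H = "last_coord_hyperplane k" and ?lam = "- (real n * ln eps)"
  have k: "k \<ge> 1" using assms(1) by simp
  note H = last_coord_hyperplane_in_hyperplanes[OF k]
  have Crho: "q \<in> Crho k \<longleftrightarrow> coord k q \<in> simplex_sphere k (1 / real (card ?H))" for q
    using Crho_iff_coord[OF k] card_last_coord_hyperplane[OF k] by simp
  have qcheck: "qcheck k \<in> Crho k"
    unfolding Crho coord_qcheck[OF k] by (rule uniform_off_in_simplex_sphere[OF H])
  have "?lam > 0" using assms by (simp add: mult_pos_neg)
  then obtain r where r: "r > 0" and local_min: "\<And>x. x \<in> simplex_sphere k (1 / real (card ?H)) \<Longrightarrow>
      L2_set (\<lambda>v. x v - uniform_off k ?H v) (Wsp k) < r \<Longrightarrow>
      exp_sum k ?lam (uniform_off k ?H) \<le> exp_sum k ?lam x"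
    using exp_sum_uniform_off_local_min[OF H _ last_coord_hyperplane_nontrivial[OF assms(1)]]
    by blast
  have "loss k n eps (qcheck k) \<le> loss k n eps q" if "q \<in> Crho k" "vdist k (qcheck k) q < r" for q
  proof -
    have "exp_sum k ?lam (coord k (qcheck k)) \<le> exp_sum k ?lam (coord k q)"
      using local_min[of "coord k q"] that
      by (simp add: Crho vdist_eq_L2_set_coord coord_qcheck[OF k])
    then show ?thesis by (simp add: loss_eq_exp_sum[OF assms(3)] qcheck that(1))
  qed
  then show ?thesis using qcheck r unfolding local_min_on_def by blast
qed

end
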